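(* Let $k$ be a complete ultrametric field with residue field $\tilde{k}$ and $\mathrm{char}(\tilde{k}) \neq 2$. Suppose that $\dim_{\mathbb{Q}} \sqrt{|k^*|} = n$ is finite. Then $u(k) \leq 2^n u(\tilde{k})$.
   Context: An ultrametric (non-Archimedean) field is a field $k$ equipped with a non-Archimedean valuation $|\cdot| : k \to \mathbb{R}_{\geq 0}$ (written multiplicatively, i.e. a multiplicative absolute value satisfying $|x+y| \leq \max(|x|,|y|)$); it is complete if every Cauchy sequence converges. Its valuation ring is $k^\circ = \{x : |x| \leq 1\}$, with maximal ideal $k^{\circ\circ} = \{x : |x|<1\}$ and residue field $\tilde{k} = k^\circ/k^{\circ\circ}$. The value group is $|k^*| \subseteq \mathbb{R}_{>0}$. For a subgroup $M \subseteq \mathbb{R}_{>0}$, the divisible closure is $\sqrt{M} = \{a \in \mathbb{R}_{>0} : a^z \in M \text{ for some } z \in \mathbb{Z}\setminus\{0\}\}$, which is a $\mathbb{Q}$-vector space (written multiplicatively, with scalars acting as exponents). For a field $K$ with $\mathrm{char}(K) \neq 2$, the $u$-invariant $u(K)$ is the maximal dimension of anisotropic quadratic forms over $K$, with $u(K) = \infty$ if there are anisotropic quadratic forms over $K$ of arbitrarily large dimension. *)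

theory Defs
  imports
    "HOL-Algebra.QuotRing"
    "HOL-Analysis.Abstract_Metric_Spaces"
    "HOL-Library.Extended_Nat"
    "Jordan_Normal_Form.VS_Connect"
begin

section \<open>Ultrametric fields\<close>

text \<open>The trivial absolute value is allowed.\<close>

locale ultrametric_field = field k for k :: "('a, 'b) ring_scheme" (structure) +
  fixes v :: "'a \<Rightarrow> real"
  assumes val_nonneg: "x \<in> carrier k \<Longrightarrow> 0 \<le> v x"
    and val_eq_0_iff: "x \<in> carrier k \<Longrightarrow> v x = 0 \<longleftrightarrow> x = \<zero>"
    and val_mult: "x \<in> carrier k \<Longrightarrow> y \<in> carrier k \<Longrightarrow> v (x \<otimes> y) = v x * v y"
    and val_add: "x \<in> carrier k \<Longrightarrow> y \<in> carrier k \<Longrightarrow> v (x \<oplus> y) \<le> max (v x) (v y)"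

text \<open>The library's \<^locale>\<open>Metric_space\<close> demands nonnegativity and symmetry of the distance also
  outside the carrier, hence the truncation.\<close>

definition val_dist :: "('a, 'b) ring_scheme \<Rightarrow> ('a \<Rightarrow> real) \<Rightarrow> 'a \<Rightarrow> 'a \<Rightarrow> real"
  where "val_dist k v x y =
    (if x \<in> carrier k \<and> y \<in> carrier k then v (x \<ominus>\<^bsub>k\<^esub> y) else 0)"

locale complete_ultrametric_field = ultrametric_field +
  assumes complete: "Metric_space.mcomplete (carrier k) (val_dist k v)"

definition valuation_ring :: "('a, 'b) ring_scheme \<Rightarrow> ('a \<Rightarrow> real) \<Rightarrow> ('a, 'b) ring_scheme"
  where "valuation_ring k v = k\<lparr>carrier := {x \<in> carrier k. v x \<le> 1}\<rparr>"

definition valuation_ideal :: "('a, 'b) ring_scheme \<Rightarrow> ('a \<Rightarrow> real) \<Rightarrow> 'a set"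
  where "valuation_ideal k v = {x \<in> carrier k. v x < 1}"

definition residue_field :: "('a, 'b) ring_scheme \<Rightarrow> ('a \<Rightarrow> real) \<Rightarrow> 'a set ring"
  where "residue_field k v = valuation_ring k v Quot valuation_ideal k v"

definition value_group :: "('a, 'b) ring_scheme \<Rightarrow> ('a \<Rightarrow> real) \<Rightarrow> real set"
  where "value_group k v = v ` (carrier k - {\<zero>\<^bsub>k\<^esub>})"

definition characteristic :: "('a, 'b) ring_scheme \<Rightarrow> nat"
  where "characteristic R =
    (if \<exists>m::nat. 0 < m \<and> [m] \<cdot>\<^bsub>R\<^esub> \<one>\<^bsub>R\<^esub> = \<zero>\<^bsub>R\<^esub>
     then LEAST m. 0 < m \<and> [m] \<cdot>\<^bsub>R\<^esub> \<one>\<^bsub>R\<^esub> = \<zero>\<^bsub>R\<^esub> else 0)"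


section \<open>The divisible closure as a rational vector space\<close>

definition divisible_closure :: "real set \<Rightarrow> real set"
  where "divisible_closure M = {a. 0 < a \<and> (\<exists>z::int. z \<noteq> 0 \<and> a powi z \<in> M)}"

text \<open>
  Vector addition is multiplication of reals, the zero vector is the real number 1, and a rational
  scalar acts as an exponent. The fields \<open>mult\<close> and \<open>one\<close>, which a module record inherits
  from ring records, play no role.
\<close>

definition divisible_closure_space :: "real set \<Rightarrow> (rat, real) module"
  where "divisible_closure_space M =
    \<lparr>carrier = divisible_closure M, mult = (*), one = 1, zero = 1, add = (*),
     smult = (\<lambda>q a. a powr of_rat q)\<rparr>"


section \<open>Quadratic forms and the u-invariant\<close>

text \<open>
  A quadratic form of dimension \<open>m\<close> is a homogeneous quadratic polynomial in variables indexed by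
  \<open>{..<m}\<close>; \<open>c i j\<close> with \<open>i \<le> j\<close> is the coefficient of the product of variables \<open>i\<close> and \<open>j\<close>.
  All other values of \<open>c\<close> are irrelevant.
\<close>

definition quadratic_form :: "('a, 'b) ring_scheme \<Rightarrow> nat \<Rightarrow> (nat \<Rightarrow> nat \<Rightarrow> 'a) \<Rightarrow> bool"
  where "quadratic_form K m c \<longleftrightarrow> (\<forall>i j. i \<le> j \<and> j < m \<longrightarrow> c i j \<in> carrier K)"

definition qf_eval ::
    "('a, 'b) ring_scheme \<Rightarrow> nat \<Rightarrow> (nat \<Rightarrow> nat \<Rightarrow> 'a) \<Rightarrow> (nat \<Rightarrow> 'a) \<Rightarrow> 'a"
  where "qf_eval K m c x =
    (\<Oplus>\<^bsub>K\<^esub>i\<in>{..<m}. \<Oplus>\<^bsub>K\<^esub>j\<in>{i..<m}. c i j \<otimes>\<^bsub>K\<^esub> x i \<otimes>\<^bsub>K\<^esub> x j)"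

definition anisotropic :: "('a, 'b) ring_scheme \<Rightarrow> nat \<Rightarrow> (nat \<Rightarrow> nat \<Rightarrow> 'a) \<Rightarrow> bool"
  where "anisotropic K m c \<longleftrightarrow>
    (\<forall>x \<in> {..<m} \<rightarrow> carrier K. qf_eval K m c x = \<zero>\<^bsub>K\<^esub> \<longrightarrow> (\<forall>i<m. x i = \<zero>\<^bsub>K\<^esub>))"

text \<open>
  The supremum in \<^typ>\<open>enat\<close> is the maximum when the dimensions are bounded and \<open>\<infinity>\<close> otherwise;
  the set always contains 0.
\<close>

definition u_invariant :: "('a, 'b) ring_scheme \<Rightarrow> enat"
  where "u_invariant K = Sup {enat m |m. \<exists>c. quadratic_form K m c \<and> anisotropic K m c}"

end

theory Submission
  imports Defs "HOL-Algebra.Subrings"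
begin

text \<open>
  An anisotropic form over \<open>k\<close> is diagonalised by completing squares, and its diagonal coefficients
  are sorted by the class of their absolute value modulo squares of the value group. Within one
  class the coefficients can be rescaled to units. If there were more than \<open>u\<close> of the residue field
  of them, the reduced form would be isotropic, and a residual zero lifts because \<open>1 + a\<close> is a
  square whenever \<open>\<bar>a\<bar> < 1\<close> (as 2 is a unit). There are at most \<open>2 ^ n\<close> classes: elements of the value
  group that are independent modulo squares are linearly independent over the rationals, since a
  minimal integral multiplicative relation has an odd exponent.
\<close>

section \<open>Square classes of the value group\<close>

text \<open>The value group need not be finitely generated (the powers of 2 with exponents in Z[1/3]
  have rational dimension 1), so the proof picks no basis of it. It bounds only the quotient by
  squares, a vector space over the field with two elements; subsets of a finite set serve as its
  coefficient vectors, whence the power of 2. The form is never decomposed into residue forms: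
  subforms of an anisotropic form are anisotropic, so for an upper bound it suffices to find one
  square class containing a large share of the diagonal entries. A residual zero is lifted by
  arbitrary representatives, after which a single coordinate of absolute value 1 is corrected by a
  square root. The hypothesis on the characteristic enters through
  \<open>v (\<one> \<oplus> \<one>) = 1\<close>: it makes 2 invertible for completing squares, and
  it makes division by 2 preserve absolute values, which keeps the iteration for the square root
  contracting.\<close>

locale positive_real_group =
  fixes M :: "real set"
  assumes pos: "a \<in> M \<Longrightarrow> 0 < a"
    and one_mem: "1 \<in> M"
    and mult_mem: "a \<in> M \<Longrightarrow> b \<in> M \<Longrightarrow> a * b \<in> M"
    and inverse_mem: "a \<in> M \<Longrightarrow> inverse a \<in> M"
begin

lemma power_mem: "a \<in> M \<Longrightarrow> a ^ i \<in> M"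
  by (induction i) (auto simp: one_mem mult_mem)

lemma powi_mem: "a \<in> M \<Longrightarrow> a powi z \<in> M"
  by (auto simp: power_int_def power_mem inverse_mem)

lemma prod_mem: "f ` A \<subseteq> M \<Longrightarrow> prod f A \<in> M"
  by (induction A rule: infinite_finite_induct) (auto simp: one_mem mult_mem)

lemma subset_divisible_closure: "M \<subseteq> divisible_closure M"
  unfolding divisible_closure_def by (auto simp: pos intro: exI[of _ 1])

lemma vectorspace_divisible_closure:
  "vectorspace (class_ring :: rat ring) (divisible_closure_space M)"
proof (rule vs_criteria)
  show "field (class_ring :: rat ring)"
    by (rule class_field)
  have mult: "a * b \<in> divisible_closure M"
    if a: "a \<in> divisible_closure M" and b: "b \<in> divisible_closure M" for a b
  proof -
    from a obtain z where z: "0 < a" "z \<noteq> 0" "a powi z \<in> M"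
      unfolding divisible_closure_def by auto
    from b obtain w where w: "0 < b" "w \<noteq> 0" "b powi w \<in> M"
      unfolding divisible_closure_def by auto
    \<comment> \<open>The product of the two exponents works for both factors at once.\<close>
    have "(a * b) powi (z * w) = (a powi z) powi w * (b powi w) powi z"
      by (simp add: power_int_mult_distrib flip: power_int_mult) (simp add: mult.commute)
    then have "(a * b) powi (z * w) \<in> M"
      using z w by (simp add: powi_mem mult_mem)
    with z w show ?thesis
      unfolding divisible_closure_def by (auto intro!: exI[of _ "z * w"])
  qed
  have scale: "a powr of_rat q \<in> divisible_closure M" if a: "a \<in> divisible_closure M" for a q
  proof -
    from a obtain z where z: "0 < a" "z \<noteq> 0" "a powi z \<in> M"
      unfolding divisible_closure_def by auto
    obtain r s where rs: "quotient_of q = (r, s)"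
      by (cases "quotient_of q")
    have s: "s > 0" and q: "q = of_int r / of_int s"
      using quotient_of_denom_pos[OF rs] quotient_of_div[OF rs] by auto
    have qr: "(of_rat q :: real) = of_int r / of_int s"
      by (simp add: q of_rat_divide)
    \<comment> \<open>The factor \<open>s\<close> clears the denominator of \<open>q\<close>, and
      \<open>z\<close> brings \<open>a\<close> into \<open>M\<close>.\<close>
    have "(a powr of_rat q) powi (s * z) = a powr (of_rat q * of_int (s * z))"
      using z by (simp add: powr_powr flip: powr_real_of_int')
    also have "of_rat q * of_int (s * z) = (of_int (z * r) :: real)"
      using s by (simp add: qr)
    also have "a powr of_int (z * r) = (a powi z) powi r"
      using z by (subst powr_real_of_int') (auto simp: power_int_mult)
    finally have "(a powr of_rat q) powi (s * z) \<in> M"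
      using z by (simp add: powi_mem)
    with z s show ?thesis
      unfolding divisible_closure_def by (auto intro!: exI[of _ "s * z"])
  qed
  have inv: "inverse a \<in> divisible_closure M" if "a \<in> divisible_closure M" for a
    using that unfolding divisible_closure_def
    by (auto simp: power_int_inverse inverse_mem)
  show "\<zero>\<^bsub>divisible_closure_space M\<^esub> \<in> carrier (divisible_closure_space M)"
    using subset_divisible_closure one_mem by (auto simp: divisible_closure_space_def)
  show "\<forall>v\<in>carrier (divisible_closure_space M). \<exists>neg_v\<in>carrier (divisible_closure_space M).
      v \<oplus>\<^bsub>divisible_closure_space M\<^esub> neg_v = \<zero>\<^bsub>divisible_closure_space M\<^esub>"
  proof
    fix a assume "a \<in> carrier (divisible_closure_space M)"
    then show "\<exists>b\<in>carrier (divisible_closure_space M).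
        a \<oplus>\<^bsub>divisible_closure_space M\<^esub> b = \<zero>\<^bsub>divisible_closure_space M\<^esub>"
      using inv[of a]
      by (intro bexI[of _ "inverse a"]) (auto simp: divisible_closure_space_def divisible_closure_def)
  qed
  show "\<forall>a b v. a \<in> carrier (class_ring :: rat ring) \<and> b \<in> carrier class_ring \<and>
      v \<in> carrier (divisible_closure_space M) \<longrightarrow>
      (a \<otimes>\<^bsub>class_ring\<^esub> b) \<odot>\<^bsub>divisible_closure_space M\<^esub> v =
      a \<odot>\<^bsub>divisible_closure_space M\<^esub> (b \<odot>\<^bsub>divisible_closure_space M\<^esub> v)"
    by (simp add: divisible_closure_space_def powr_powr of_rat_mult mult.commute)
  show "\<forall>a v w. a \<in> carrier (class_ring :: rat ring) \<and>
      v \<in> carrier (divisible_closure_space M) \<and> w \<in> carrier (divisible_closure_space M) \<longrightarrow>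
      a \<odot>\<^bsub>divisible_closure_space M\<^esub> (v \<oplus>\<^bsub>divisible_closure_space M\<^esub> w) =
      a \<odot>\<^bsub>divisible_closure_space M\<^esub> v \<oplus>\<^bsub>divisible_closure_space M\<^esub>
      a \<odot>\<^bsub>divisible_closure_space M\<^esub> w"
    by (simp add: divisible_closure_space_def divisible_closure_def powr_mult)
  show "\<forall>a b v. a \<in> carrier (class_ring :: rat ring) \<and> b \<in> carrier class_ring \<and>
      v \<in> carrier (divisible_closure_space M) \<longrightarrow>
      (a \<oplus>\<^bsub>class_ring\<^esub> b) \<odot>\<^bsub>divisible_closure_space M\<^esub> v =
      a \<odot>\<^bsub>divisible_closure_space M\<^esub> v \<oplus>\<^bsub>divisible_closure_space M\<^esub>
      b \<odot>\<^bsub>divisible_closure_space M\<^esub> v"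
    by (simp add: divisible_closure_space_def of_rat_add powr_add)
  show "\<forall>v\<in>carrier (divisible_closure_space M).
      \<one>\<^bsub>class_ring :: rat ring\<^esub> \<odot>\<^bsub>divisible_closure_space M\<^esub> v = v"
    by (auto simp: divisible_closure_space_def divisible_closure_def)
  show "\<forall>v w. v \<in> carrier (divisible_closure_space M) \<and> w \<in> carrier (divisible_closure_space M) \<longrightarrow>
      v \<oplus>\<^bsub>divisible_closure_space M\<^esub> w \<in> carrier (divisible_closure_space M)"
    using mult by (simp add: divisible_closure_space_def)
  show "\<forall>c v. c \<in> carrier (class_ring :: rat ring) \<and> v \<in> carrier (divisible_closure_space M) \<longrightarrow>
      c \<odot>\<^bsub>divisible_closure_space M\<^esub> v \<in> carrier (divisible_closure_space M)"
    using scale by (simp add: divisible_closure_space_def)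
qed (simp_all add: divisible_closure_space_def mult.commute mult.left_commute)

lemma lincomb_divisible_closure_space:
  assumes "finite A" "A \<subseteq> M"
  shows "module.lincomb (divisible_closure_space M) c A = (\<Prod>a\<in>A. a powr of_rat (c a))"
proof -
  interpret V: vectorspace "class_ring :: rat ring" "divisible_closure_space M"
    by (rule vectorspace_divisible_closure)
  have carr: "c a \<odot>\<^bsub>divisible_closure_space M\<^esub> a \<in> carrier (divisible_closure_space M)"
    if "a \<in> A" for a
    using that assms subset_divisible_closure
    by (intro V.smult_closed) (auto simp: divisible_closure_space_def)
  \<comment> \<open>Claiming this for all subsets of the fixed set \<open>A\<close> keeps
    \<open>carr\<close> available during the induction.\<close>
  have "finsum (divisible_closure_space M) (\<lambda>a. c a \<odot>\<^bsub>divisible_closure_space M\<^esub> a) B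
      = (\<Prod>a\<in>B. a powr of_rat (c a))" if "B \<subseteq> A" for B
    using finite_subset[OF that \<open>finite A\<close>] that
  proof (induction B rule: finite_induct)
    case empty
    show ?case
      by (simp only: V.finsum_empty prod.empty) (simp add: divisible_closure_space_def)
  next
    case (insert x B)
    then show ?case
      using carr by (subst V.finsum_insert) (auto simp: divisible_closure_space_def)
  qed
  then show ?thesis
    by (simp add: V.lincomb_def)
qed

end

section \<open>Integral multiplicative relations between positive reals\<close>

lemma common_denominator:
  fixes c :: "'b \<Rightarrow> rat"
  assumes "finite A"
  shows "\<exists>D::int. D > 0 \<and> (\<forall>a\<in>A. \<exists>b::int. c a * of_int D = of_int b)"
  using assms
proof (induction A rule: finite_induct)
  case empty
  show ?case by (auto intro: exI[of _ 1])
next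
  case (insert x A)
  then obtain D where D: "D > 0" "\<forall>a\<in>A. \<exists>b::int. c a * of_int D = of_int b"
    by auto
  obtain r s where rs: "quotient_of (c x) = (r, s)"
    by (cases "quotient_of (c x)")
  have s: "s > 0" and q: "c x = of_int r / of_int s"
    using quotient_of_denom_pos[OF rs] quotient_of_div[OF rs] by auto
  have "\<exists>b::int. c a * of_int (s * D) = of_int b" if a: "a \<in> insert x A" for a
  proof (cases "a = x")
    case True
    have "c a * of_int (s * D) = of_int (r * D)"
      using s by (simp add: True q)
    then show ?thesis by blast
  next
    case False
    with a D obtain b where "c a * of_int D = of_int b"
      by auto
    then have "c a * of_int (s * D) = of_int (s * b)"
      by (metis mult.left_commute of_int_mult)
    then show ?thesis by blast
  qed
  with D s show ?case
    by (intro exI[of _ "s * D"]) auto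
qed

text \<open>Infinite descent: as long as all exponents are even, halving them gives a smaller
  nontrivial relation.\<close>

lemma odd_multiplicative_relation:
  fixes b :: "real \<Rightarrow> int"
  assumes "finite A" "\<And>a. a \<in> A \<Longrightarrow> 0 < a" "(\<Prod>a\<in>A. a powi b a) = 1" "\<exists>a\<in>A. b a \<noteq> 0"
  shows "\<exists>c. (\<Prod>a\<in>A. a powi c a) = 1 \<and> (\<exists>a\<in>A. odd (c a))"
  using assms(3,4)
proof (induction "\<Sum>a\<in>A. nat \<bar>b a\<bar>" arbitrary: b rule: less_induct)
  case less
  show ?case
  proof (cases "\<exists>a\<in>A. odd (b a)")
    case True
    with less.prems show ?thesis by blast
  next
    case False
    define c where "c a = b a div 2" for a
    have b: "b a = c a * 2" if "a \<in> A" for a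
      using False that by (auto simp: c_def)
    have "(\<Prod>a\<in>A. a powi c a)\<^sup>2 = (\<Prod>a\<in>A. a powi b a)"
      by (simp add: b power_int_mult flip: prod_power_distrib)
    \<comment> \<open>The halved product squares to 1; positivity rules out the value -1.\<close>
    moreover have "(\<Prod>a\<in>A. a powi c a) > 0"
      using assms(2) by (intro prod_pos) simp
    ultimately have "(\<Prod>a\<in>A. a powi c a) = 1"
      using less.prems by (simp add: power2_eq_1_iff)
    moreover have "\<exists>a\<in>A. c a \<noteq> 0"
      using less.prems b by fastforce
    \<comment> \<open>Halving shrinks no exponent below zero in size, and it strictly shrinks the
      one that is nonzero.\<close>
    moreover have "(\<Sum>a\<in>A. nat \<bar>c a\<bar>) < (\<Sum>a\<in>A. nat \<bar>b a\<bar>)"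
      using \<open>\<exists>a\<in>A. c a \<noteq> 0\<close> \<open>finite A\<close> by (intro sum_strict_mono_ex1) (auto simp: b)
    ultimately show ?thesis
      by (intro less.hyps[of c])
  qed
qed

context positive_real_group
begin

text \<open>Linear independence of \<open>S\<close> in \<open>M\<close> modulo squares over the
  field with two elements: a set \<open>T\<close> encodes a vector of 0-1 coefficients.\<close>

definition square_independent :: "real set \<Rightarrow> bool"
  where "square_independent S \<longleftrightarrow> (\<forall>T\<subseteq>S. T \<noteq> {} \<longrightarrow> \<not> (\<exists>h\<in>M. \<Prod>T = h\<^sup>2))"

text \<open>A rational relation yields an integral one with an odd exponent. Modulo squares only the
  odd exponents survive, and the elements carrying them multiply to a square.\<close>

lemma square_independent_lin_indpt:
  assumes "S \<subseteq> M" "square_independent S"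
  shows "\<not> module.lin_dep (class_ring :: rat ring) (divisible_closure_space M) S"
proof
  interpret V: vectorspace "class_ring :: rat ring" "divisible_closure_space M"
    by (rule vectorspace_divisible_closure)
  assume "V.lin_dep S"
  then obtain A c w where A: "finite A" "A \<subseteq> S" "w \<in> A" "c w \<noteq> 0"
      and "V.lincomb c A = \<zero>\<^bsub>divisible_closure_space M\<^esub>"
    unfolding V.lin_dep_def by auto
  then have rel: "(\<Prod>a\<in>A. a powr of_rat (c a)) = 1"
    using \<open>S \<subseteq> M\<close> by (subst (asm) lincomb_divisible_closure_space) (auto simp: divisible_closure_space_def)
  have A_pos: "0 < a" if "a \<in> A" for a
    using that A \<open>S \<subseteq> M\<close> pos by blast
  obtain D :: int where D: "D > 0" "\<forall>a\<in>A. \<exists>b::int. c a * of_int D = of_int b"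
    using common_denominator[OF \<open>finite A\<close>, of c] by auto
  then obtain b where b: "\<And>a. a \<in> A \<Longrightarrow> c a * of_int D = of_int (b a)"
    by metis
  have b': "of_rat (c a) * of_int D = (of_int (b a) :: real)" if "a \<in> A" for a
    using arg_cong[OF b[OF that], of "of_rat :: rat \<Rightarrow> real"] by (simp add: of_rat_mult)
  \<comment> \<open>Raising the relation to the power \<open>D\<close> clears all
    denominators.\<close>
  have "(\<Prod>a\<in>A. a powi b a) = (\<Prod>a\<in>A. (a powr of_rat (c a)) powr of_int D)"
    using A_pos by (intro prod.cong) (simp_all add: powr_powr b' powr_real_of_int' less_imp_le less_imp_neq[THEN not_sym])
  also have "\<dots> = (\<Prod>a\<in>A. a powr of_rat (c a)) powr of_int D"
    by (simp add: prod_powr_distrib)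
  finally have "(\<Prod>a\<in>A. a powi b a) = 1"
    by (simp add: rel)
  moreover have "b w \<noteq> 0"
    using b[of w] A D by auto
  ultimately obtain e where e: "(\<Prod>a\<in>A. a powi e a) = 1" "\<exists>a\<in>A. odd (e a)"
    using odd_multiplicative_relation[OF \<open>finite A\<close> A_pos, of b] A by blast
  define T where "T = {a \<in> A. odd (e a)}"
  define h where "h = (\<Prod>a\<in>A. a powi (e a div 2))"
  have "h \<in> M"
    unfolding h_def using A \<open>S \<subseteq> M\<close> by (intro prod_mem) (auto intro: powi_mem)
  \<comment> \<open>Integer division rounds down, so the remainder is 0 or 1 for negative exponents
    too.\<close>
  have "a powi e a = (a powi (e a div 2))\<^sup>2 * (if odd (e a) then a else 1)" if "a \<in> A" for a
  proof -
    have "a powi e a = a powi (e a div 2 * 2 + e a mod 2)"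
      by simp
    also have "\<dots> = (a powi (e a div 2))\<^sup>2 * a powi (e a mod 2)"
      using A_pos[OF that] by (subst power_int_add) (auto simp: power_int_mult)
    finally show ?thesis
      by (cases "odd (e a)") (simp_all add: odd_iff_mod_2_eq_one)
  qed
  then have "1 = h\<^sup>2 * (\<Prod>a\<in>A. if odd (e a) then a else 1)"
    unfolding h_def e(1)[symmetric] by (simp add: prod.distrib prod_power_distrib)
  also have "(\<Prod>a\<in>A. if odd (e a) then a else 1) = \<Prod>T"
    unfolding T_def using \<open>finite A\<close> by (simp add: prod.inter_filter)
  finally have "\<Prod>T = (inverse h)\<^sup>2"
    using pos[OF \<open>h \<in> M\<close>] by (simp add: field_simps)
  moreover have "T \<subseteq> S" "T \<noteq> {}"
    using A e by (auto simp: T_def)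
  ultimately show False
    using assms(2) inverse_mem[OF \<open>h \<in> M\<close>] unfolding square_independent_def by blast
qed

text \<open>A square-independent set of largest size spans the square classes. The conclusion
  multiplies \<open>g\<close> by \<open>\<Prod>T\<close> instead of comparing the two: in the
  quotient by squares every element is its own inverse, and this form directly supplies a scaling
  factor.\<close>

lemma square_class_representatives:
  assumes "vectorspace.fin_dim (class_ring :: rat ring) (divisible_closure_space M)"
    and "vectorspace.dim (class_ring :: rat ring) (divisible_closure_space M) = n"
  obtains S where "finite S" "card S \<le> n" "S \<subseteq> M"
    "\<And>g. g \<in> M \<Longrightarrow> \<exists>T\<subseteq>S. \<exists>h\<in>M. g * \<Prod>T = h\<^sup>2"
proof -
  interpret V: vectorspace "class_ring :: rat ring" "divisible_closure_space M"
    by (rule vectorspace_divisible_closure)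
  define P where "P S \<longleftrightarrow> S \<subseteq> M \<and> square_independent S" for S
  have bound: "finite S \<and> card S \<le> n" if "P S" for S
    using V.li_le_dim[OF assms(1), of S] that square_independent_lin_indpt[of S] subset_divisible_closure assms(2)
    unfolding P_def by (auto simp: divisible_closure_space_def)
  have "P {}"
    by (simp add: P_def square_independent_def)
  then obtain S where S: "P S" and max: "\<And>S'. P S' \<Longrightarrow> card S' \<le> card S"
    using ex_has_greatest_nat[of P "{}" card "Suc n"] bound by (metis less_Suc_eq_le)
  have "finite S" "S \<subseteq> M"
    using bound S by (auto simp: P_def)
  have "\<exists>T\<subseteq>S. \<exists>h\<in>M. g * \<Prod>T = h\<^sup>2" if g: "g \<in> M" for g
  \<comment> \<open>For \<open>g\<close> in \<open>S\<close> inserting it does not enlarge the set,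
    so maximality says nothing; there \<open>g * g\<close> is already a square.\<close>
  proof (cases "g \<in> S")
    case True
    then show ?thesis
      using g by (intro exI[of _ "{g}"]) (auto simp: power2_eq_square)
  next
    case False
    then have "\<not> P (insert g S)"
      using max[of "insert g S"] \<open>finite S\<close> by auto
    then obtain T h where T: "T \<subseteq> insert g S" "T \<noteq> {}" "h \<in> M" "\<Prod>T = h\<^sup>2"
      using g \<open>S \<subseteq> M\<close> by (auto simp: P_def square_independent_def)
    \<comment> \<open>Otherwise \<open>T\<close> would lie in \<open>S\<close> and contradict its
      independence.\<close>
    with S have "g \<in> T"
      unfolding P_def square_independent_def by blast
    then have "g * \<Prod>(T - {g}) = h\<^sup>2"
      using T \<open>finite S\<close> by (metis finite_insert finite_subset prod.remove)
    with T show ?thesis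
      by (intro exI[of _ "T - {g}"]) auto
  qed
  with that[of S] \<open>finite S\<close> \<open>S \<subseteq> M\<close> bound[OF S] show ?thesis
    by blast
qed

end


section \<open>Diagonalisation\<close>

lemma quadratic_form_SucD: "quadratic_form R (Suc m) c \<Longrightarrow> quadratic_form R m c"
  by (simp add: quadratic_form_def)

section \<open>Evaluating forms by recursion on the number of variables\<close>

context cring
begin

lemma qf_eval_0: "qf_eval R 0 c x = \<zero>"
  by (simp add: qf_eval_def)

lemma qf_eval_closed:
  assumes "quadratic_form R m c" "x \<in> {..<m} \<rightarrow> carrier R"
  shows "qf_eval R m c x \<in> carrier R"
  using assms unfolding qf_eval_def quadratic_form_def
  by (intro finsum_closed) (auto intro!: finsum_closed m_closed)

text \<open>The terms are grouped by their degree in the last variable; this recursion drives the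
  inductions below and exhibits the square to be completed.\<close>

lemma qf_eval_Suc:
  assumes c: "quadratic_form R (Suc m) c" and x: "x \<in> {..<Suc m} \<rightarrow> carrier R"
  shows "qf_eval R (Suc m) c x =
    qf_eval R m c x \<oplus> (\<Oplus>i\<in>{..<m}. c i m \<otimes> x i) \<otimes> x m \<oplus> c m m \<otimes> (x m \<otimes> x m)"
proof -
  have [simp]: "x i \<in> carrier R" if "i \<le> m" for i
    using x that by auto
  have [simp]: "c i j \<in> carrier R" if "i \<le> j" "j \<le> m" for i j
    using c that by (simp add: quadratic_form_def)
  have row: "(\<Oplus>j\<in>{i..<Suc m}. c i j \<otimes> x i \<otimes> x j) =
      (\<Oplus>j\<in>{i..<m}. c i j \<otimes> x i \<otimes> x j) \<oplus> c i m \<otimes> x i \<otimes> x m" if "i \<le> m" for i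
    using that by (simp add: atLeastLessThanSuc) (intro a_comm; auto intro!: finsum_closed)
  have "qf_eval R (Suc m) c x =
      (\<Oplus>i\<in>{..<m}. \<Oplus>j\<in>{i..<Suc m}. c i j \<otimes> x i \<otimes> x j) \<oplus> c m m \<otimes> x m \<otimes> x m"
    unfolding qf_eval_def lessThan_Suc by (subst finsum_insert) (auto intro!: a_comm finsum_closed)
  also have "(\<Oplus>i\<in>{..<m}. \<Oplus>j\<in>{i..<Suc m}. c i j \<otimes> x i \<otimes> x j) =
      (\<Oplus>i\<in>{..<m}. (\<Oplus>j\<in>{i..<m}. c i j \<otimes> x i \<otimes> x j) \<oplus> c i m \<otimes> x i \<otimes> x m)"
    by (intro finsum_cong') (auto simp: row intro!: finsum_closed)
  also have "\<dots> = qf_eval R m c x \<oplus> (\<Oplus>i\<in>{..<m}. c i m \<otimes> x i \<otimes> x m)"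
    unfolding qf_eval_def by (intro finsum_addf) (auto intro!: finsum_closed)
  also have "(\<Oplus>i\<in>{..<m}. c i m \<otimes> x i \<otimes> x m) = (\<Oplus>i\<in>{..<m}. c i m \<otimes> x i) \<otimes> x m"
    by (rule finsum_ldistr[symmetric]) auto
  finally show ?thesis
    by (simp add: m_assoc)
qed

lemma qf_eval_cong:
  assumes "quadratic_form R m c" "x \<in> {..<m} \<rightarrow> carrier R" "\<And>i. i < m \<Longrightarrow> x i = y i"
  shows "qf_eval R m c x = qf_eval R m c y"
  using assms unfolding qf_eval_def quadratic_form_def
  by (intro finsum_cong') (auto intro!: finsum_closed finsum_cong' simp: Pi_iff)

lemma qf_eval_zero_vector:
  assumes "quadratic_form R m c" "\<And>i. i < m \<Longrightarrow> x i = \<zero>"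
  shows "qf_eval R m c x = \<zero>"
  using assms unfolding qf_eval_def quadratic_form_def
  by (auto intro!: add.finprod_one_eqI)

text \<open>Completing a square alters the remaining form by a multiple of a squared linear form;
  this lemma evaluates the result.\<close>

lemma qf_eval_add_smult:
  assumes "quadratic_form R m c" "quadratic_form R m b" "e \<in> carrier R" "x \<in> {..<m} \<rightarrow> carrier R"
  shows "qf_eval R m (\<lambda>i j. c i j \<oplus> e \<otimes> b i j) x = qf_eval R m c x \<oplus> e \<otimes> qf_eval R m b x"
  using assms
proof (induction m)
  case 0
  then show ?case by (simp add: qf_eval_0)
next
  case (Suc m)
  note qf = Suc.prems(1,2)
  have [simp]: "c i j \<in> carrier R" "b i j \<in> carrier R" if "i \<le> j" "j \<le> m" for i j
    using qf that by (simp_all add: quadratic_form_def)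
  have [simp]: "x i \<in> carrier R" if "i \<le> m" for i
    using Suc.prems(4) that by auto
  have [simp]: "qf_eval R m c x \<in> carrier R" "qf_eval R m b x \<in> carrier R"
    using qf by (auto intro!: qf_eval_closed dest: quadratic_form_SucD)
  have [simp]: "(\<Oplus>i\<in>{..<m}. c i m \<otimes> x i) \<in> carrier R" "(\<Oplus>i\<in>{..<m}. b i m \<otimes> x i) \<in> carrier R"
    by (auto intro!: finsum_closed)
  have qf': "quadratic_form R (Suc m) (\<lambda>i j. c i j \<oplus> e \<otimes> b i j)"
    using \<open>e \<in> carrier R\<close> by (simp add: quadratic_form_def)
  have IH: "qf_eval R m (\<lambda>i j. c i j \<oplus> e \<otimes> b i j) x = qf_eval R m c x \<oplus> e \<otimes> qf_eval R m b x"
    using qf \<open>e \<in> carrier R\<close> by (intro Suc.IH) (auto dest: quadratic_form_SucD)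
  have "(\<Oplus>i\<in>{..<m}. (c i m \<oplus> e \<otimes> b i m) \<otimes> x i) =
      (\<Oplus>i\<in>{..<m}. c i m \<otimes> x i \<oplus> e \<otimes> (b i m \<otimes> x i))"
    using \<open>e \<in> carrier R\<close> by (intro finsum_cong') (auto simp: l_distr m_assoc)
  also have "\<dots> = (\<Oplus>i\<in>{..<m}. c i m \<otimes> x i) \<oplus> (\<Oplus>i\<in>{..<m}. e \<otimes> (b i m \<otimes> x i))"
    using \<open>e \<in> carrier R\<close> by (intro finsum_addf) auto
  also have "(\<Oplus>i\<in>{..<m}. e \<otimes> (b i m \<otimes> x i)) = e \<otimes> (\<Oplus>i\<in>{..<m}. b i m \<otimes> x i)"
    using \<open>e \<in> carrier R\<close> by (intro finsum_rdistr[symmetric]) auto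
  finally have lin: "(\<Oplus>i\<in>{..<m}. (c i m \<oplus> e \<otimes> b i m) \<otimes> x i) =
      (\<Oplus>i\<in>{..<m}. c i m \<otimes> x i) \<oplus> e \<otimes> (\<Oplus>i\<in>{..<m}. b i m \<otimes> x i)" .
  \<comment> \<open>With the sums abstracted to variables, the induction step is a plain ring
    identity.\<close>
  have "(q1 \<oplus> e \<otimes> q2) \<oplus> (s1 \<oplus> e \<otimes> s2) \<otimes> z \<oplus> (a1 \<oplus> e \<otimes> a2) \<otimes> (z \<otimes> z) =
      (q1 \<oplus> s1 \<otimes> z \<oplus> a1 \<otimes> (z \<otimes> z)) \<oplus> e \<otimes> (q2 \<oplus> s2 \<otimes> z \<oplus> a2 \<otimes> (z \<otimes> z))"
    if "q1 \<in> carrier R" "q2 \<in> carrier R" "s1 \<in> carrier R" "s2 \<in> carrier R"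
      "a1 \<in> carrier R" "a2 \<in> carrier R" "z \<in> carrier R" for q1 q2 s1 s2 a1 a2 z
    using that \<open>e \<in> carrier R\<close> by algebra
  then show ?case
    unfolding qf_eval_Suc[OF qf(1) Suc.prems(4)] qf_eval_Suc[OF qf(2) Suc.prems(4)]
      qf_eval_Suc[OF qf' Suc.prems(4)] IH lin
    by simp
qed

text \<open>Only pairs with \<open>i \<le> j\<close> contribute to a form, so each mixed product
  occurs once and has to carry the factor 2.\<close>

lemma qf_eval_square_linear:
  assumes "l \<in> {..<m} \<rightarrow> carrier R" "x \<in> {..<m} \<rightarrow> carrier R"
  shows "qf_eval R m (\<lambda>i j. if i = j then l i \<otimes> l i else (\<one> \<oplus> \<one>) \<otimes> (l i \<otimes> l j)) x =
    (\<Oplus>i\<in>{..<m}. l i \<otimes> x i) \<otimes> (\<Oplus>i\<in>{..<m}. l i \<otimes> x i)"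
  using assms
proof (induction m)
  case 0
  then show ?case by (simp add: qf_eval_0)
next
  case (Suc m)
  let ?b = "\<lambda>i j. if i = j then l i \<otimes> l i else (\<one> \<oplus> \<one>) \<otimes> (l i \<otimes> l j)"
  define s where "s = (\<Oplus>i\<in>{..<m}. l i \<otimes> x i)"
  have [simp]: "x i \<in> carrier R" "l i \<in> carrier R" if "i \<le> m" for i
    using Suc.prems that by auto
  have [simp]: "s \<in> carrier R"
    unfolding s_def by (auto intro!: finsum_closed)
  have qf: "quadratic_form R (Suc m) ?b"
    by (simp add: quadratic_form_def)
  have "(\<Oplus>i\<in>{..<m}. ?b i m \<otimes> x i) = (\<Oplus>i\<in>{..<m}. ((\<one> \<oplus> \<one>) \<otimes> l m) \<otimes> (l i \<otimes> x i))"
    by (intro finsum_cong') (auto simp: m_ac)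
  also have "\<dots> = ((\<one> \<oplus> \<one>) \<otimes> l m) \<otimes> s"
    unfolding s_def by (intro finsum_rdistr[symmetric]) auto
  finally have lin: "(\<Oplus>i\<in>{..<m}. ?b i m \<otimes> x i) = ((\<one> \<oplus> \<one>) \<otimes> l m) \<otimes> s" .
  have sum: "(\<Oplus>i\<in>{..<Suc m}. l i \<otimes> x i) = s \<oplus> l m \<otimes> x m"
    unfolding s_def lessThan_Suc by (subst finsum_insert) (auto intro!: a_comm finsum_closed)
  have IH: "qf_eval R m ?b x = s \<otimes> s"
    unfolding s_def by (rule Suc.IH) auto
  have "s \<otimes> s \<oplus> ((\<one> \<oplus> \<one>) \<otimes> l m) \<otimes> s \<otimes> x m \<oplus> (l m \<otimes> l m) \<otimes> (x m \<otimes> x m) =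
      (s \<oplus> l m \<otimes> x m) \<otimes> (s \<oplus> l m \<otimes> x m)"
    if "l m \<in> carrier R" "x m \<in> carrier R"
    using that \<open>s \<in> carrier R\<close> by algebra
  then show ?case
    unfolding qf_eval_Suc[OF qf Suc.prems(2)] sum IH lin by simp
qed

end

section \<open>Completing squares over a field in which 2 is nonzero\<close>

context field
begin

text \<open>The change of basis fixes the first \<open>m\<close> coordinates and replaces the last
  one by \<open>y\<close> minus a linear form. Giving the substituted vector explicitly avoids
  matrices.\<close>

lemma complete_square:
  assumes "quadratic_form R (Suc m) c" and a: "c m m \<noteq> \<zero>" and two: "\<one> \<oplus> \<one> \<noteq> \<zero>"
  obtains c' l where "quadratic_form R m c'" "l \<in> {..<m} \<rightarrow> carrier R"
    "\<And>x y. x \<in> {..<m} \<rightarrow> carrier R \<Longrightarrow> y \<in> carrier R \<Longrightarrow>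
      qf_eval R (Suc m) c (x(m := y \<ominus> (\<Oplus>i\<in>{..<m}. l i \<otimes> x i))) =
      qf_eval R m c' x \<oplus> c m m \<otimes> (y \<otimes> y)"
proof -
  define a where "a = c m m"
  have [simp]: "c i j \<in> carrier R" if "i \<le> j" "j \<le> m" for i j
    using assms(1) that by (simp add: quadratic_form_def)
  have [simp]: "a \<in> carrier R" by (simp add: a_def)
  define h where "h = inv ((\<one> \<oplus> \<one>) \<otimes> a)"
  have "(\<one> \<oplus> \<one>) \<otimes> a \<in> Units R"
    using a two by (auto simp: field_Units integral_iff a_def)
  then have [simp]: "h \<in> carrier R" and h: "(\<one> \<oplus> \<one>) \<otimes> a \<otimes> h = \<one>"
    by (auto simp: h_def)
  \<comment> \<open>With \<open>h = 1/(2a)\<close> one has \<open>a(y - ht)\<^sup>2 + t(y - ht) = ay\<^sup>2 + (ah\<^sup>2 - h)t\<^sup>2\<close>.\<close>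
  define e where "e = a \<otimes> (h \<otimes> h) \<ominus> h"
  have [simp]: "e \<in> carrier R" by (simp add: e_def)
  define b where "b i j = (if i = j then c i m \<otimes> c i m else (\<one> \<oplus> \<one>) \<otimes> (c i m \<otimes> c j m))" for i j
  have qf: "quadratic_form R m c" and qfb: "quadratic_form R m b"
    using assms(1) by (simp_all add: quadratic_form_def b_def)
  show ?thesis
  proof (rule that)
    show "quadratic_form R m (\<lambda>i j. c i j \<oplus> e \<otimes> b i j)"
      using qf qfb by (simp add: quadratic_form_def)
    show "(\<lambda>i. h \<otimes> c i m) \<in> {..<m} \<rightarrow> carrier R"
      by auto
    fix x y assume x: "x \<in> {..<m} \<rightarrow> carrier R" and y: "y \<in> carrier R"
    have [simp]: "x i \<in> carrier R" if "i < m" for i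
      using x that by auto
    define t where "t = (\<Oplus>i\<in>{..<m}. c i m \<otimes> x i)"
    have t: "t \<in> carrier R"
      unfolding t_def by (auto intro!: finsum_closed)
    have ht: "(\<Oplus>i\<in>{..<m}. (h \<otimes> c i m) \<otimes> x i) = h \<otimes> t"
    proof -
      have "(\<Oplus>i\<in>{..<m}. (h \<otimes> c i m) \<otimes> x i) = (\<Oplus>i\<in>{..<m}. h \<otimes> (c i m \<otimes> x i))"
        by (intro finsum_cong') (auto simp: m_assoc)
      then show ?thesis
        unfolding t_def by (subst finsum_rdistr) auto
    qed
    define z where "z = y \<ominus> h \<otimes> t"
    have z: "z \<in> carrier R"
      using y t by (simp add: z_def)
    have [simp]: "qf_eval R m c x \<in> carrier R"
      using qf x by (rule qf_eval_closed)
    have "qf_eval R m c (x(m := z)) = qf_eval R m c x"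
      using x qf by (intro qf_eval_cong) auto
    moreover have "(\<Oplus>i\<in>{..<m}. c i m \<otimes> (x(m := z)) i) = t"
      unfolding t_def by (intro finsum_cong') auto
    ultimately have "qf_eval R (Suc m) c (x(m := z)) = qf_eval R m c x \<oplus> t \<otimes> z \<oplus> a \<otimes> (z \<otimes> z)"
      using x z by (subst qf_eval_Suc[OF assms(1)]) (auto simp: a_def)
    \<comment> \<open>This holds for any \<open>h\<close>, so \<open>algebra\<close> can prove it;
      the choice of \<open>h\<close> then makes the last summand vanish.\<close>
    also have "\<dots> = q \<oplus> e \<otimes> (t \<otimes> t) \<oplus> a \<otimes> (y \<otimes> y) \<oplus> (\<one> \<ominus> (\<one> \<oplus> \<one>) \<otimes> a \<otimes> h) \<otimes> (t \<otimes> y)"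
      if q: "q = qf_eval R m c x" "q \<in> carrier R" for q
      unfolding z_def e_def q(1)[symmetric]
      using y t q(2) \<open>a \<in> carrier R\<close> \<open>h \<in> carrier R\<close> by algebra
    finally have 1: "qf_eval R (Suc m) c (x(m := z)) =
        qf_eval R m c x \<oplus> e \<otimes> (t \<otimes> t) \<oplus> a \<otimes> (y \<otimes> y)"
      using y t by (simp add: h minus_eq r_neg)
    have 2: "t \<otimes> t = qf_eval R m b x"
      unfolding b_def t_def using x by (intro qf_eval_square_linear[symmetric]) auto
    have 3: "qf_eval R m (\<lambda>i j. c i j \<oplus> e \<otimes> b i j) x = qf_eval R m c x \<oplus> e \<otimes> qf_eval R m b x"
      using qf qfb x by (intro qf_eval_add_smult) auto
    show "qf_eval R (Suc m) c (x(m := y \<ominus> (\<Oplus>i\<in>{..<m}. (h \<otimes> c i m) \<otimes> x i))) =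
        qf_eval R m (\<lambda>i j. c i j \<oplus> e \<otimes> b i j) x \<oplus> c m m \<otimes> (y \<otimes> y)"
      unfolding ht z_def[symmetric] 1 2 3 by (simp only: a_def)
  qed
qed

text \<open>In place of an invertible change of basis, it asks only that each \<open>y\<close> come
  from some \<open>x\<close> with the same value and that \<open>x = 0\<close> force
  \<open>y = 0\<close>. That is enough to transfer anisotropy. Anisotropy also guarantees a nonzero
  last diagonal coefficient at every stage, so no basis vector has to be searched for.\<close>

lemma anisotropic_diagonalization:
  assumes "quadratic_form R m c" "anisotropic R m c" and two: "\<one> \<oplus> \<one> \<noteq> \<zero>"
  shows "\<exists>d\<in>{..<m} \<rightarrow> carrier R. \<forall>y\<in>{..<m} \<rightarrow> carrier R. \<exists>x\<in>{..<m} \<rightarrow> carrier R.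
    qf_eval R m c x = (\<Oplus>i\<in>{..<m}. d i \<otimes> (y i \<otimes> y i)) \<and>
    ((\<forall>i<m. x i = \<zero>) \<longrightarrow> (\<forall>i<m. y i = \<zero>))"
  using assms(1,2)
proof (induction m arbitrary: c)
  case 0
  then show ?case by (auto simp: qf_eval_0)
next
  case (Suc m)
  note aniso = Suc.prems(2)[unfolded anisotropic_def, rule_format]
  have [simp]: "c i j \<in> carrier R" if "i \<le> j" "j \<le> m" for i j
    using Suc.prems(1) that by (simp add: quadratic_form_def)
  have "c m m \<noteq> \<zero>"
  proof
    assume "c m m = \<zero>"
    \<comment> \<open>The form takes the value \<open>c m m\<close> at the last basis
      vector.\<close>
    define x where "x i = (if i = m then \<one> else \<zero>)" for i
    have x: "x \<in> {..<Suc m} \<rightarrow> carrier R"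
      by (auto simp: x_def)
    have "(\<Oplus>i\<in>{..<m}. c i m \<otimes> x i) = \<zero>"
      by (intro add.finprod_one_eqI) (auto simp: x_def)
    moreover have "qf_eval R m c x = \<zero>"
      using Suc.prems(1) by (intro qf_eval_zero_vector) (auto simp: x_def dest: quadratic_form_SucD)
    ultimately have "qf_eval R (Suc m) c x = \<zero>"
      by (subst qf_eval_Suc[OF Suc.prems(1) x]) (simp add: \<open>c m m = \<zero>\<close> x_def)
    from aniso[OF x this, of m] show False
      by (simp add: x_def)
  qed
  then obtain c' l where c': "quadratic_form R m c'" and l: "l \<in> {..<m} \<rightarrow> carrier R"
    and eval: "\<And>x y. x \<in> {..<m} \<rightarrow> carrier R \<Longrightarrow> y \<in> carrier R \<Longrightarrow>
      qf_eval R (Suc m) c (x(m := y \<ominus> (\<Oplus>i\<in>{..<m}. l i \<otimes> x i))) =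
      qf_eval R m c' x \<oplus> c m m \<otimes> (y \<otimes> y)"
    using complete_square[OF Suc.prems(1) _ two] by blast
  have lin: "(\<Oplus>i\<in>{..<m}. l i \<otimes> x i) \<in> carrier R" if "x \<in> {..<m} \<rightarrow> carrier R" for x
    using l that by (auto intro!: finsum_closed)
  have upd: "x(m := y \<ominus> (\<Oplus>i\<in>{..<m}. l i \<otimes> x i)) \<in> {..<Suc m} \<rightarrow> carrier R"
    if "x \<in> {..<m} \<rightarrow> carrier R" "y \<in> carrier R" for x y
    using that lin[OF that(1)] by (auto simp: less_Suc_eq)
  have "anisotropic R m c'"
    unfolding anisotropic_def
  proof (intro ballI impI allI)
    fix x i assume x: "x \<in> {..<m} \<rightarrow> carrier R" and "qf_eval R m c' x = \<zero>" "i < m"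
    \<comment> \<open>A zero of the remaining form extends to a zero of \<open>c\<close> by taking
      the new last coordinate to be 0.\<close>
    then have "qf_eval R (Suc m) c (x(m := \<zero> \<ominus> (\<Oplus>i\<in>{..<m}. l i \<otimes> x i))) = \<zero>"
      by (simp add: eval)
    from aniso[OF upd[OF x zero_closed] this, of i] \<open>i < m\<close> show "x i = \<zero>"
      by simp
  qed
  from Suc.IH[OF c' this] obtain d where d: "d \<in> {..<m} \<rightarrow> carrier R"
    and rep: "\<And>y. y \<in> {..<m} \<rightarrow> carrier R \<Longrightarrow> \<exists>x\<in>{..<m} \<rightarrow> carrier R.
      qf_eval R m c' x = (\<Oplus>i\<in>{..<m}. d i \<otimes> (y i \<otimes> y i)) \<and>
      ((\<forall>i<m. x i = \<zero>) \<longrightarrow> (\<forall>i<m. y i = \<zero>))"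
    by blast
  show ?case
  proof (rule bexI[of _ "d(m := c m m)"], rule ballI)
    show "d(m := c m m) \<in> {..<Suc m} \<rightarrow> carrier R"
      using d by (auto simp: less_Suc_eq)
    fix y assume y: "y \<in> {..<Suc m} \<rightarrow> carrier R"
    then have "y \<in> {..<m} \<rightarrow> carrier R"
      by auto
    from rep[OF this] obtain x where x: "x \<in> {..<m} \<rightarrow> carrier R"
      and eq: "qf_eval R m c' x = (\<Oplus>i\<in>{..<m}. d i \<otimes> (y i \<otimes> y i))"
      and nz: "(\<forall>i<m. x i = \<zero>) \<longrightarrow> (\<forall>i<m. y i = \<zero>)"
      by blast
    let ?x = "x(m := y m \<ominus> (\<Oplus>i\<in>{..<m}. l i \<otimes> x i))"
    have ym: "y m \<in> carrier R"
      using y by auto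
    have sumc: "(\<Oplus>i\<in>{..<m}. d i \<otimes> (y i \<otimes> y i)) \<in> carrier R"
      using d y by (auto intro!: finsum_closed simp: Pi_iff)
    have "(\<Oplus>i\<in>{..<Suc m}. (d(m := c m m)) i \<otimes> (y i \<otimes> y i)) =
        c m m \<otimes> (y m \<otimes> y m) \<oplus> (\<Oplus>i\<in>{..<m}. (d(m := c m m)) i \<otimes> (y i \<otimes> y i))"
      unfolding lessThan_Suc using d y by (subst finsum_insert) (auto simp: Pi_iff)
    also have "(\<Oplus>i\<in>{..<m}. (d(m := c m m)) i \<otimes> (y i \<otimes> y i)) = (\<Oplus>i\<in>{..<m}. d i \<otimes> (y i \<otimes> y i))"
      using d y by (intro finsum_cong') (auto simp: Pi_iff)
    finally have "qf_eval R (Suc m) c ?x = (\<Oplus>i\<in>{..<Suc m}. (d(m := c m m)) i \<otimes> (y i \<otimes> y i))"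
      using eval[OF x ym] eq ym sumc by (simp add: a_comm)
    \<comment> \<open>If the first coordinates of \<open>?x\<close> vanish, so does the linear form,
      and its last coordinate is then \<open>y m\<close> itself.\<close>
    moreover have "\<forall>i<Suc m. y i = \<zero>" if zero: "\<forall>i<Suc m. ?x i = \<zero>"
    proof -
      have x0: "x i = \<zero>" if "i < m" for i
        using zero[rule_format, of i] that by simp
      have "(\<Oplus>i\<in>{..<m}. l i \<otimes> x i) = \<zero>"
        using l by (intro add.finprod_one_eqI) (auto simp: x0 Pi_iff)
      with zero[rule_format, of m] ym have "y m = \<zero>"
        by (simp add: a_minus_def)
      with nz x0 show ?thesis
        by (auto simp: less_Suc_eq)
    qed
    ultimately show "\<exists>x\<in>{..<Suc m} \<rightarrow> carrier R.
        qf_eval R (Suc m) c x = (\<Oplus>i\<in>{..<Suc m}. (d(m := c m m)) i \<otimes> (y i \<otimes> y i)) \<and>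
        ((\<forall>i<Suc m. x i = \<zero>) \<longrightarrow> (\<forall>i<Suc m. y i = \<zero>))"
      using upd[OF x ym] by blast
  qed
qed

text \<open>An arbitrary index set lets subforms be taken without renumbering the variables.\<close>

definition diagonal_anisotropic :: "'i set \<Rightarrow> ('i \<Rightarrow> 'a) \<Rightarrow> bool"
  where "diagonal_anisotropic I d \<longleftrightarrow>
    (\<forall>y\<in>I \<rightarrow> carrier R. (\<Oplus>i\<in>I. d i \<otimes> (y i \<otimes> y i)) = \<zero> \<longrightarrow> (\<forall>i\<in>I. y i = \<zero>))"

lemma anisotropic_imp_diagonal_anisotropic:
  assumes "quadratic_form R m c" "anisotropic R m c" "\<one> \<oplus> \<one> \<noteq> \<zero>"
  obtains d where "d \<in> {..<m} \<rightarrow> carrier R" "diagonal_anisotropic {..<m} d"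
proof -
  obtain d where d: "d \<in> {..<m} \<rightarrow> carrier R"
    and rep: "\<And>y. y \<in> {..<m} \<rightarrow> carrier R \<Longrightarrow> \<exists>x\<in>{..<m} \<rightarrow> carrier R.
      qf_eval R m c x = (\<Oplus>i\<in>{..<m}. d i \<otimes> (y i \<otimes> y i)) \<and>
      ((\<forall>i<m. x i = \<zero>) \<longrightarrow> (\<forall>i<m. y i = \<zero>))"
    using anisotropic_diagonalization[OF assms] by blast
  have "diagonal_anisotropic {..<m} d"
    unfolding diagonal_anisotropic_def
    using rep assms(2) unfolding anisotropic_def by (metis lessThan_iff)
  with d that show ?thesis by blast
qed

text \<open>A zero of the subform, extended by 0, is a zero of the whole form.\<close>

lemma diagonal_anisotropic_subset:
  assumes "diagonal_anisotropic I d" "finite I" "J \<subseteq> I" "d \<in> I \<rightarrow> carrier R"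
  shows "diagonal_anisotropic J d"
  unfolding diagonal_anisotropic_def
proof (intro ballI impI)
  fix y j assume y: "y \<in> J \<rightarrow> carrier R" and zero: "(\<Oplus>i\<in>J. d i \<otimes> (y i \<otimes> y i)) = \<zero>" and j: "j \<in> J"
  define z where "z i = (if i \<in> J then y i else \<zero>)" for i
  have z: "z \<in> I \<rightarrow> carrier R"
    using y by (auto simp: z_def)
  have "(\<Oplus>i\<in>J. d i \<otimes> (y i \<otimes> y i)) = (\<Oplus>i\<in>I. d i \<otimes> (z i \<otimes> z i))"
    using assms y by (intro add.finprod_mono_neutral_cong_left) (auto simp: z_def Pi_iff subset_iff)
  with assms(1) z zero have "\<forall>i\<in>I. z i = \<zero>"
    unfolding diagonal_anisotropic_def by auto
  with j assms(3) have "z j = \<zero>"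
    by blast
  with j show "y j = \<zero>"
    by (simp add: z_def)
qed

text \<open>A zero entry would make the corresponding basis vector isotropic, as the one-variable
  subform shows.\<close>

lemma diagonal_anisotropic_nonzero:
  assumes "diagonal_anisotropic I d" "finite I" "i \<in> I" "d \<in> I \<rightarrow> carrier R"
  shows "d i \<noteq> \<zero>"
proof
  assume "d i = \<zero>"
  have "diagonal_anisotropic {i} d"
    using assms by (intro diagonal_anisotropic_subset[OF assms(1)]) auto
  then have "(\<Oplus>j\<in>{i}. d j \<otimes> (\<one> \<otimes> \<one>)) = \<zero> \<longrightarrow> (\<forall>j\<in>{i}. \<one> = \<zero>)"
    unfolding diagonal_anisotropic_def by (rule bspec[of _ _ "\<lambda>_. \<one>"]) auto
  moreover have "(\<Oplus>j\<in>{i}. d j \<otimes> (\<one> \<otimes> \<one>)) = \<zero>"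
    using \<open>d i = \<zero>\<close> by (intro add.finprod_one_eqI) auto
  ultimately show False by simp
qed

text \<open>Leads from a square class of indices back to an initial segment of the naturals, where
  \<open>u_invariant\<close> applies.\<close>

lemma diagonal_anisotropic_reindex:
  assumes "diagonal_anisotropic (e ` J) d" "inj_on e J" "d \<in> e ` J \<rightarrow> carrier R"
  shows "diagonal_anisotropic J (d \<circ> e)"
  unfolding diagonal_anisotropic_def
proof (intro ballI impI)
  fix y j assume y: "y \<in> J \<rightarrow> carrier R" and j: "j \<in> J"
    and zero: "(\<Oplus>i\<in>J. (d \<circ> e) i \<otimes> (y i \<otimes> y i)) = \<zero>"
  define z where "z = y \<circ> the_inv_into J e"
  have z_e: "z (e i) = y i" if "i \<in> J" for i
    using that assms(2) by (simp add: z_def the_inv_into_f_f)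
  have z: "z \<in> e ` J \<rightarrow> carrier R"
    using y z_e by (auto simp: Pi_iff)
  have "(\<Oplus>i\<in>e ` J. d i \<otimes> (z i \<otimes> z i)) = (\<Oplus>i\<in>J. d (e i) \<otimes> (z (e i) \<otimes> z (e i)))"
    using z assms by (intro finsum_reindex) (auto simp: Pi_iff)
  also have "\<dots> = (\<Oplus>i\<in>J. (d \<circ> e) i \<otimes> (y i \<otimes> y i))"
    using y assms(3) by (intro finsum_cong') (auto simp: Pi_iff z_e)
  finally have "(\<Oplus>i\<in>e ` J. d i \<otimes> (z i \<otimes> z i)) = \<zero>"
    by (simp only: zero)
  with assms(1) z j have "z (e j) = \<zero>"
    unfolding diagonal_anisotropic_def by blast
  then show "y j = \<zero>"
    using z_e[OF j] by simp
qed

text \<open>The squares are absorbed by the substitution of \<open>b i \<otimes> y i\<close> for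
  \<open>y i\<close>, and the common factor \<open>a\<close> cancels.\<close>

lemma diagonal_anisotropic_scale:
  assumes "diagonal_anisotropic I d" "d \<in> I \<rightarrow> carrier R" "a \<in> carrier R" "a \<noteq> \<zero>"
    and b: "\<And>i. i \<in> I \<Longrightarrow> b i \<in> carrier R" "\<And>i. i \<in> I \<Longrightarrow> b i \<noteq> \<zero>"
  shows "diagonal_anisotropic I (\<lambda>i. a \<otimes> (d i \<otimes> (b i \<otimes> b i)))"
  unfolding diagonal_anisotropic_def
proof (intro ballI impI)
  fix y j assume y: "y \<in> I \<rightarrow> carrier R" and j: "j \<in> I"
    and zero: "(\<Oplus>i\<in>I. a \<otimes> (d i \<otimes> (b i \<otimes> b i)) \<otimes> (y i \<otimes> y i)) = \<zero>"
  have carr: "d i \<in> carrier R" "y i \<in> carrier R" if "i \<in> I" for i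
    using y assms(2) that by auto
  have z: "(\<lambda>i. b i \<otimes> y i) \<in> I \<rightarrow> carrier R"
    using carr b by auto
  have eq: "a \<otimes> (d i \<otimes> (b i \<otimes> b i)) \<otimes> (y i \<otimes> y i) = a \<otimes> (d i \<otimes> ((b i \<otimes> y i) \<otimes> (b i \<otimes> y i)))"
    if "i \<in> I" for i
    using carr[OF that] b(1)[OF that] assms(3) by (simp add: m_ac)
  have sum: "(\<Oplus>i\<in>I. d i \<otimes> ((b i \<otimes> y i) \<otimes> (b i \<otimes> y i))) \<in> carrier R"
    using carr b by (intro finsum_closed) auto
  have "(\<Oplus>i\<in>I. a \<otimes> (d i \<otimes> (b i \<otimes> b i)) \<otimes> (y i \<otimes> y i)) =
      (\<Oplus>i\<in>I. a \<otimes> (d i \<otimes> ((b i \<otimes> y i) \<otimes> (b i \<otimes> y i))))"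
    using carr b assms(3) by (intro finsum_cong' refl eq) auto
  also have "\<dots> = a \<otimes> (\<Oplus>i\<in>I. d i \<otimes> ((b i \<otimes> y i) \<otimes> (b i \<otimes> y i)))"
  \<comment> \<open>Over an infinite index set both sums take the default value zero.\<close>
  proof (cases "finite I")
    case True
    then show ?thesis
      using carr b assms(3) by (intro finsum_rdistr[symmetric]) auto
  qed (use assms(3) in \<open>simp add: finsum_infinite\<close>)
  finally have "(\<Oplus>i\<in>I. d i \<otimes> ((b i \<otimes> y i) \<otimes> (b i \<otimes> y i))) = \<zero>"
    using zero assms(3,4) sum integral by metis
  then have "b j \<otimes> y j = \<zero>"
    using assms(1)[unfolded diagonal_anisotropic_def, rule_format, OF z _ j] by simp
  then show "y j = \<zero>"
    using b[OF j] carr[OF j] integral by blast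
qed

end


section \<open>Square roots in complete ultrametric fields\<close>

context ultrametric_field
begin

lemma val_zero [simp]: "v \<zero> = 0"
  by (simp add: val_eq_0_iff)

lemma val_pos: "x \<in> carrier k \<Longrightarrow> x \<noteq> \<zero> \<Longrightarrow> 0 < v x"
  using val_nonneg[of x] val_eq_0_iff[of x] by linarith

lemma val_one [simp]: "v \<one> = 1"
  using val_mult[of \<one> \<one>] val_eq_0_iff[of \<one>] by simp

lemma val_minus [simp]: "x \<in> carrier k \<Longrightarrow> v (\<ominus> x) = v x"
proof -
  assume x: "x \<in> carrier k"
  have "v (\<ominus> \<one>) * v (\<ominus> \<one>) = v ((\<ominus> \<one>) \<otimes> (\<ominus> \<one>))"
    by (simp add: val_mult)
  also have "(\<ominus> \<one>) \<otimes> (\<ominus> \<one>) = \<one>"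
    by (simp add: l_minus)
  finally have "v (\<ominus> \<one>) = 1"
    using val_nonneg[of "\<ominus> \<one>"] by (simp add: square_eq_1_iff)
  moreover have "\<ominus> x = \<ominus> \<one> \<otimes> x"
    using x by (simp add: l_minus)
  ultimately show ?thesis
    using x by (simp add: val_mult)
qed

lemma val_diff: "x \<in> carrier k \<Longrightarrow> y \<in> carrier k \<Longrightarrow> v (x \<ominus> y) \<le> max (v x) (v y)"
  using val_add[of x "\<ominus> y"] by (simp add: minus_eq)

lemma val_diff_commute: "x \<in> carrier k \<Longrightarrow> y \<in> carrier k \<Longrightarrow> v (x \<ominus> y) = v (y \<ominus> x)"
  using val_minus[of "x \<ominus> y"] by (simp add: minus_add minus_eq a_comm)

lemma val_diff_trans:
  assumes "x \<in> carrier k" "y \<in> carrier k" "z \<in> carrier k"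
  shows "v (x \<ominus> z) \<le> max (v (x \<ominus> y)) (v (y \<ominus> z))"
proof -
  have "x \<ominus> z = (x \<ominus> y) \<oplus> (y \<ominus> z)"
    using assms by algebra
  then show ?thesis
    using assms val_add[of "x \<ominus> y" "y \<ominus> z"] by simp
qed

lemma val_inv: "x \<in> carrier k \<Longrightarrow> x \<noteq> \<zero> \<Longrightarrow> v (inv x) = inverse (v x)"
  using val_mult[of x "inv x"] by (simp add: field_Units inverse_unique)

lemma val_finsum_le:
  assumes "finite A" "f \<in> A \<rightarrow> carrier k" "\<And>a. a \<in> A \<Longrightarrow> v (f a) \<le> C" "0 \<le> C"
  shows "v (\<Oplus>a\<in>A. f a) \<le> C"
  using assms
proof (induction A rule: finite_induct)
  case empty
  then show ?case by simp
next
  case (insert a A)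
  then have "v (f a \<oplus> (\<Oplus>a\<in>A. f a)) \<le> max (v (f a)) (v (\<Oplus>a\<in>A. f a))"
    by (intro val_add finsum_closed) auto
  also have "\<dots> \<le> C"
    using insert by auto
  finally show ?case
    using insert by (subst finsum_insert) auto
qed

lemma Metric_space_val_dist: "Metric_space (carrier k) (val_dist k v)"
proof
  show "0 \<le> val_dist k v x y" for x y
    by (simp add: val_dist_def val_nonneg)
  show "val_dist k v x y = val_dist k v y x" for x y
    by (simp add: val_dist_def val_diff_commute)
  show "val_dist k v x y = 0 \<longleftrightarrow> x = y" if "x \<in> carrier k" "y \<in> carrier k" for x y
    using that by (simp add: val_dist_def val_eq_0_iff r_right_minus_eq)
  show "val_dist k v x z \<le> val_dist k v x y + val_dist k v y z"
    if "x \<in> carrier k" "y \<in> carrier k" "z \<in> carrier k" for x y z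
    using that val_diff_trans[of x y z] val_nonneg[of "x \<ominus> y"] val_nonneg[of "y \<ominus> z"]
    by (simp add: val_dist_def)
qed

end

context complete_ultrametric_field
begin

text \<open>An instance of Hensel's lemma, proved by iteration: the root is sought near 1.\<close>

lemma one_plus_small_is_square:
  assumes a: "a \<in> carrier k" "v a < 1" and two: "v (\<one> \<oplus> \<one>) = 1"
  obtains z where "z \<in> carrier k" "z \<otimes> z = \<one> \<oplus> a"
proof -
  interpret M: Metric_space "carrier k" "val_dist k v"
    by (rule Metric_space_val_dist)
  define r where "r = v a"
  have r: "0 \<le> r" "r < 1"
    using a by (simp_all add: r_def val_nonneg)
  have "\<one> \<oplus> \<one> \<noteq> \<zero>"
    using two by auto
  then have unit: "\<one> \<oplus> \<one> \<in> Units k"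
    by (simp add: field_Units)
  define h where "h = inv (\<one> \<oplus> \<one>)"
  have h: "h \<in> carrier k" "(\<one> \<oplus> \<one>) \<otimes> h = \<one>"
    using unit by (simp_all add: h_def)
  have vh: "v h = 1"
    using \<open>\<one> \<oplus> \<one> \<noteq> \<zero>\<close> two by (simp add: h_def val_inv)
  \<comment> \<open>\<open>(1 + z)\<^sup>2 = 1 + a\<close> says that \<open>z\<close> is a fixed point of \<open>x \<mapsto> (a - x\<^sup>2) / 2\<close>, which contracts the ball of
    radius \<open>\<bar>a\<bar>\<close>.\<close>
  define s where "s = rec_nat \<zero> (\<lambda>_ x. h \<otimes> (a \<ominus> x \<otimes> x))"
  have s_0: "s 0 = \<zero>" and s_Suc: "s (Suc i) = h \<otimes> (a \<ominus> s i \<otimes> s i)" for i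
    by (simp_all add: s_def)
  have s: "s i \<in> carrier k \<and> v (s i) \<le> r" for i
  proof (induction i)
    case 0
    then show ?case using r by (simp add: s_0)
  next
    case (Suc i)
    have "v (s (Suc i)) = v (a \<ominus> s i \<otimes> s i)"
      using Suc h a by (simp add: s_Suc val_mult vh)
    also have "\<dots> \<le> max (v a) (v (s i \<otimes> s i))"
      using Suc a by (intro val_diff) auto
    \<comment> \<open>One factor is bounded by \<open>r\<close>, the other merely by 1.\<close>
    also have "v (s i \<otimes> s i) \<le> r"
      using Suc r val_nonneg[of "s i"] mult_mono[of "v (s i)" r "v (s i)" 1] by (simp add: val_mult)
    finally show ?case
      using Suc h a by (simp add: s_Suc r_def)
  qed
  then have sc [simp]: "s i \<in> carrier k" for i by blast
  have step: "v (s (Suc i) \<ominus> s i) \<le> r ^ Suc i" for i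
  proof (induction i)
    case 0
    then show ?case using s[of 1] by (simp add: s_0 minus_eq)
  next
    case (Suc i)
    \<comment> \<open>A difference of squares: the sum of two iterates has absolute value at most
      \<open>r\<close>, which is the contraction factor.\<close>
    have "h \<otimes> (a \<ominus> y \<otimes> y) \<ominus> h \<otimes> (a \<ominus> x \<otimes> x) = \<ominus> h \<otimes> ((y \<ominus> x) \<otimes> (y \<oplus> x))"
      if "x \<in> carrier k" "y \<in> carrier k" for x y
      using that a h(1) by algebra
    then have "s (Suc (Suc i)) \<ominus> s (Suc i) =
        \<ominus> h \<otimes> ((s (Suc i) \<ominus> s i) \<otimes> (s (Suc i) \<oplus> s i))"
      by (simp only: s_Suc[of "Suc i"] s_Suc[of i, symmetric] sc) (metis s_Suc sc)
    then have "v (s (Suc (Suc i)) \<ominus> s (Suc i)) = v (s (Suc i) \<ominus> s i) * v (s (Suc i) \<oplus> s i)"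
      using h by (simp add: val_mult vh)
    also have "\<dots> \<le> r ^ Suc i * r"
      using Suc r s[of i] s[of "Suc i"] val_add[of "s (Suc i)" "s i"] val_nonneg
      by (intro mult_mono) (auto simp del: power_Suc)
    finally show ?case by (simp add: mult.commute)
  qed
  \<comment> \<open>By the ultrametric inequality the largest step alone bounds the distance; no
    geometric series is summed.\<close>
  have tail: "v (s (N + p) \<ominus> s N) \<le> r ^ Suc N" for N p
  proof (induction p)
    case 0
    then show ?case using r by (simp add: minus_eq r_neg)
  next
    case (Suc p)
    have "v (s (Suc (N + p)) \<ominus> s N) \<le> max (v (s (Suc (N + p)) \<ominus> s (N + p))) (v (s (N + p) \<ominus> s N))"
      by (intro val_diff_trans) auto
    moreover have "r ^ Suc (N + p) \<le> r ^ Suc N"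
      using r by (intro power_decreasing) auto
    ultimately show ?case
      using Suc step[of "N + p"] by simp
  qed
  have "M.MCauchy s"
    unfolding M.MCauchy_def
  proof (intro conjI allI impI)
    show "range s \<subseteq> carrier k" by auto
    fix \<epsilon> :: real assume "0 < \<epsilon>"
    then obtain N where N: "r ^ N < \<epsilon>"
      using r real_arch_pow_inv by blast
    have "val_dist k v (s i) (s j) < \<epsilon>" if "N \<le> i" "N \<le> j" for i j
    proof -
      have "v (s i \<ominus> s j) \<le> max (v (s i \<ominus> s N)) (v (s N \<ominus> s j))"
        by (intro val_diff_trans) auto
      also have "\<dots> \<le> r ^ Suc N"
        using tail[of N "i - N"] tail[of N "j - N"] that val_diff_commute[of "s N" "s j"] by simp
      also have "\<dots> \<le> r ^ N"
        using r by (intro power_decreasing) auto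
      finally show ?thesis
        using N by (simp add: val_dist_def)
    qed
    then show "\<exists>N. \<forall>i j. N \<le> i \<longrightarrow> N \<le> j \<longrightarrow> val_dist k v (s i) (s j) < \<epsilon>"
      by blast
  qed
  then obtain z where "limitin M.mtopology s z sequentially"
    using complete M.mcomplete_def by blast
  then have z: "z \<in> carrier k"
    and lim: "\<And>\<epsilon>. \<epsilon> > 0 \<Longrightarrow> \<exists>N. \<forall>i\<ge>N. val_dist k v (s i) z < \<epsilon>"
    by (auto simp: M.limit_metric_sequentially)
  \<comment> \<open>This is the defect, the difference of \<open>(1 + z)^2\<close> and
    \<open>1 + a\<close>.\<close>
  define w where "w = z \<otimes> z \<oplus> (\<one> \<oplus> \<one>) \<otimes> z \<ominus> a"
  have w: "w \<in> carrier k"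
    using z a by (simp add: w_def)
  \<comment> \<open>The defect is estimated through two consecutive iterates close to
    \<open>z\<close>, using that they satisfy the recurrence exactly.\<close>
  have small: "v w \<le> \<epsilon>" if \<epsilon>: "0 < \<epsilon>" "\<epsilon> < 1" for \<epsilon>
  proof -
    obtain N where N: "\<forall>i\<ge>N. val_dist k v (s i) z < \<epsilon>"
      using lim \<epsilon> by blast
    have close: "v (z \<ominus> s i) < \<epsilon>" if "i \<ge> N" for i
      using N that z val_diff_commute[of z "s i"] by (auto simp: val_dist_def)
    define x y where "x = s N" and "y = s (Suc N)"
    have x: "x \<in> carrier k" "v x \<le> r" and y: "y \<in> carrier k"
      using s by (simp_all add: x_def y_def)
    have "z \<oplus> x = (z \<ominus> x) \<oplus> (\<one> \<oplus> \<one>) \<otimes> x"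
      using x(1) z by algebra
    then have "v (z \<oplus> x) \<le> max (v (z \<ominus> x)) (v ((\<one> \<oplus> \<one>) \<otimes> x))"
      using val_add[of "z \<ominus> x" "(\<one> \<oplus> \<one>) \<otimes> x"] x z by simp
    also have "\<dots> \<le> 1"
      using x r close[of N] \<epsilon> by (simp add: val_mult two x_def)
    finally have "v (z \<oplus> x) \<le> 1" .
    have "(\<one> \<oplus> \<one>) \<otimes> y = ((\<one> \<oplus> \<one>) \<otimes> h) \<otimes> (a \<ominus> x \<otimes> x)"
      using h(1) a(1) x(1) by (simp add: y_def s_Suc m_assoc x_def[symmetric])
    then have "(\<one> \<oplus> \<one>) \<otimes> y = a \<ominus> x \<otimes> x"
      using h a x by simp
    \<comment> \<open>The last bracket is zero by the recurrence; it is kept to make this a ring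
      identity.\<close>
    moreover have "w = ((z \<ominus> x) \<otimes> (z \<oplus> x) \<oplus> (\<one> \<oplus> \<one>) \<otimes> (z \<ominus> y)) \<oplus>
        ((\<one> \<oplus> \<one>) \<otimes> y \<ominus> (a \<ominus> x \<otimes> x))"
      unfolding w_def using x(1) y z a(1) by algebra
    ultimately have "w = (z \<ominus> x) \<otimes> (z \<oplus> x) \<oplus> (\<one> \<oplus> \<one>) \<otimes> (z \<ominus> y)"
      using x y z a by (simp add: minus_eq r_neg)
    then have "v w \<le> max (v ((z \<ominus> x) \<otimes> (z \<oplus> x))) (v ((\<one> \<oplus> \<one>) \<otimes> (z \<ominus> y)))"
      using val_add[of "(z \<ominus> x) \<otimes> (z \<oplus> x)" "(\<one> \<oplus> \<one>) \<otimes> (z \<ominus> y)"] x y z by simp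
    also have "v ((z \<ominus> x) \<otimes> (z \<oplus> x)) \<le> \<epsilon> * 1"
      using x z close[of N] \<open>v (z \<oplus> x) \<le> 1\<close> val_nonneg \<epsilon>
      by (simp only: val_mult minus_closed add.m_closed)
        (intro mult_mono, auto simp: x_def intro: less_imp_le)
    also have "v ((\<one> \<oplus> \<one>) \<otimes> (z \<ominus> y)) \<le> \<epsilon>"
      using y z close[of "Suc N"] by (simp add: val_mult two y_def)
    finally show ?thesis by simp
  qed
  have "v w \<le> 0"
  proof (rule ccontr)
    assume "\<not> v w \<le> 0"
    \<comment> \<open>Half of the minimum is below both 1 and \<open>v w\<close>.\<close>
    with small[of "min (v w) 1 / 2"] show False
      by (cases "v w \<le> 1") auto
  qed
  then have "w = \<zero>"
    using val_pos[OF w] by fastforce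
  have "(\<one> \<oplus> z) \<otimes> (\<one> \<oplus> z) = (\<one> \<oplus> a) \<oplus> w"
    unfolding w_def using z a(1) by algebra
  then have "(\<one> \<oplus> z) \<otimes> (\<one> \<oplus> z) = \<one> \<oplus> a"
    using a by (simp add: \<open>w = \<zero>\<close>)
  then show ?thesis
    using z by (intro that[of "\<one> \<oplus> z"]) auto
qed

end


section \<open>Lifting zeros from the residue field\<close>

lemma (in cring) qf_eval_diagonal:
  assumes "e \<in> {..<m} \<rightarrow> carrier R" "x \<in> {..<m} \<rightarrow> carrier R"
  shows "qf_eval R m (\<lambda>i j. if i = j then e i else \<zero>) x = (\<Oplus>i\<in>{..<m}. e i \<otimes> (x i \<otimes> x i))"
  using assms
proof (induction m)
  case 0
  then show ?case by (simp add: qf_eval_0)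
next
  case (Suc m)
  have qf: "quadratic_form R (Suc m) (\<lambda>i j. if i = j then e i else \<zero>)"
    using Suc.prems by (auto simp: quadratic_form_def)
  have carr: "e i \<in> carrier R" "x i \<in> carrier R" if "i \<le> m" for i
    using Suc.prems that by auto
  have lin: "(\<Oplus>i\<in>{..<m}. (if i = m then e i else \<zero>) \<otimes> x i) = \<zero>"
    using carr by (intro add.finprod_one_eqI) auto
  have IH: "qf_eval R m (\<lambda>i j. if i = j then e i else \<zero>) x = (\<Oplus>i\<in>{..<m}. e i \<otimes> (x i \<otimes> x i))"
    using carr by (intro Suc.IH) auto
  have sum: "(\<Oplus>i\<in>{..<m}. e i \<otimes> (x i \<otimes> x i)) \<in> carrier R"
    using carr by (intro finsum_closed) auto
  have "(\<Oplus>i\<in>{..<Suc m}. e i \<otimes> (x i \<otimes> x i)) =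
      e m \<otimes> (x m \<otimes> x m) \<oplus> (\<Oplus>i\<in>{..<m}. e i \<otimes> (x i \<otimes> x i))"
    unfolding lessThan_Suc using carr by (intro finsum_insert) auto
  with sum carr show ?case
    unfolding qf_eval_Suc[OF qf Suc.prems(2)] IH lin by (simp add: a_comm)
qed

section \<open>The valuation ring and its residue map\<close>

context ultrametric_field
begin

lemma cring_valuation_ring: "cring (valuation_ring k v)"
proof -
  have "subring {x \<in> carrier k. v x \<le> 1} k"
  proof (rule subringI)
    fix x y assume "x \<in> {x \<in> carrier k. v x \<le> 1}" "y \<in> {x \<in> carrier k. v x \<le> 1}"
    then show "x \<otimes> y \<in> {x \<in> carrier k. v x \<le> 1}" "x \<oplus> y \<in> {x \<in> carrier k. v x \<le> 1}"
      using val_add[of x y] by (auto simp: val_mult val_nonneg mult_le_one)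
  qed auto
  then show ?thesis
    unfolding valuation_ring_def
    by (subst subcring_iff[symmetric]) (auto intro: subcringI')
qed

lemma ideal_valuation_ideal: "ideal (valuation_ideal k v) (valuation_ring k v)"
proof -
  interpret V: cring "valuation_ring k v"
    by (rule cring_valuation_ring)
  have inv: "\<ominus>\<^bsub>valuation_ring k v\<^esub> x = \<ominus> x" if "x \<in> carrier (valuation_ring k v)" for x
    using that by (intro V.minus_equality) (auto simp: valuation_ring_def l_neg)
  show ?thesis
  proof (rule idealI)
    show "ring (valuation_ring k v)"
      by (rule V.ring_axioms)
    show "subgroup (valuation_ideal k v) (add_monoid (valuation_ring k v))"
    proof (rule V.add.subgroupI)
      show "valuation_ideal k v \<subseteq> carrier (valuation_ring k v)"
        by (auto simp: valuation_ideal_def valuation_ring_def)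
      show "valuation_ideal k v \<noteq> {}"
        by (auto simp: valuation_ideal_def intro!: exI[of _ \<zero>])
      fix x y assume x: "x \<in> valuation_ideal k v" and y: "y \<in> valuation_ideal k v"
      show "\<ominus>\<^bsub>valuation_ring k v\<^esub> x \<in> valuation_ideal k v"
        using x by (subst inv) (auto simp: valuation_ideal_def valuation_ring_def)
      show "x \<oplus>\<^bsub>valuation_ring k v\<^esub> y \<in> valuation_ideal k v"
        using x y val_add[of x y] by (auto simp: valuation_ideal_def valuation_ring_def)
    qed
    fix x y assume "x \<in> valuation_ideal k v" "y \<in> carrier (valuation_ring k v)"
    then have *: "x \<in> carrier k" "y \<in> carrier k" "v x * v y < 1"
      using mult_right_le_one_le[of "v x" "v y"]
      by (auto simp: valuation_ideal_def valuation_ring_def val_nonneg intro: le_less_trans)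
    then show "y \<otimes>\<^bsub>valuation_ring k v\<^esub> x \<in> valuation_ideal k v"
        "x \<otimes>\<^bsub>valuation_ring k v\<^esub> y \<in> valuation_ideal k v"
      by (auto simp: valuation_ideal_def valuation_ring_def val_mult mult.commute)
  qed
qed

abbreviation residue :: "'a \<Rightarrow> 'a set"
  where "residue x \<equiv> valuation_ideal k v +>\<^bsub>valuation_ring k v\<^esub> x"

lemma residue_hom: "ring_hom_cring (valuation_ring k v) (residue_field k v) residue"
  unfolding residue_field_def
  by (rule ideal.rcos_ring_hom_cring[OF ideal_valuation_ideal cring_valuation_ring])

lemma residue_eq_zero_iff:
  assumes "x \<in> carrier k" "v x \<le> 1"
  shows "residue x = \<zero>\<^bsub>residue_field k v\<^esub> \<longleftrightarrow> v x < 1"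
proof -
  interpret I: ideal "valuation_ideal k v" "valuation_ring k v"
    by (rule ideal_valuation_ideal)
  have "residue x = valuation_ideal k v \<longleftrightarrow> x \<in> valuation_ideal k v"
    using assms I.a_rcos_self[of x] I.a_rcos_const[of x] by (auto simp: valuation_ring_def)
  then show ?thesis
    using assms by (simp add: residue_field_def FactRing_def valuation_ideal_def)
qed

lemma residue_surj:
  assumes "X \<in> carrier (residue_field k v)"
  obtains x where "x \<in> carrier k" "v x \<le> 1" "residue x = X"
  using assms by (auto simp: residue_field_def FactRing_def A_RCOSETS_def' valuation_ring_def)

text \<open>The two rings share their operations, but \<open>finsum\<close> also depends on the
  carrier.\<close>

lemma finsum_valuation_ring:
  assumes "finite A" "f \<in> A \<rightarrow> carrier (valuation_ring k v)"
  shows "finsum (valuation_ring k v) f A = finsum k f A"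
proof -
  interpret V: cring "valuation_ring k v"
    by (rule cring_valuation_ring)
  show ?thesis
    using assms
  proof (induction A rule: finite_induct)
    case empty
    then show ?case
      by (simp only: V.finsum_empty finsum_empty) (simp add: valuation_ring_def)
  next
    case (insert a A)
    then have "f \<in> A \<rightarrow> carrier k" "f a \<in> carrier k"
      by (auto simp: valuation_ring_def)
    with insert show ?case
      by (subst V.finsum_insert) (auto simp: valuation_ring_def)
  qed
qed

text \<open>If 2 had absolute value below 1, it would vanish in the residue ring while 1 does not,
  forcing characteristic 2.\<close>

lemma val_two_eq_one:
  assumes "characteristic (residue_field k v) \<noteq> 2"
  shows "v (\<one> \<oplus> \<one>) = 1"
proof (rule ccontr)
  assume "v (\<one> \<oplus> \<one>) \<noteq> 1"
  with val_add[of \<one> \<one>] have less: "v (\<one> \<oplus> \<one>) < 1" by simp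
  interpret h: ring_hom_cring "valuation_ring k v" "residue_field k v" residue
    by (rule residue_hom)
  let ?F = "residue_field k v"
  have one: "\<one> \<in> carrier (valuation_ring k v)" "\<one>\<^bsub>valuation_ring k v\<^esub> = \<one>"
    by (auto simp: valuation_ring_def)
  have "\<one>\<^bsub>?F\<^esub> \<noteq> \<zero>\<^bsub>?F\<^esub>"
    using residue_eq_zero_iff[of \<one>] h.hom_one one by simp
  moreover have "\<one>\<^bsub>?F\<^esub> \<oplus>\<^bsub>?F\<^esub> \<one>\<^bsub>?F\<^esub> = \<zero>\<^bsub>?F\<^esub>"
    using residue_eq_zero_iff[of "\<one> \<oplus> \<one>"] less h.hom_add[OF one(1) one(1)] h.hom_one one
    by (simp add: valuation_ring_def)
  ultimately have *: "add_pow ?F (m::nat) \<one>\<^bsub>?F\<^esub> = \<zero>\<^bsub>?F\<^esub> \<Longrightarrow> 0 < m \<Longrightarrow> 2 \<le> m"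
      and **: "add_pow ?F (2::nat) \<one>\<^bsub>?F\<^esub> = \<zero>\<^bsub>?F\<^esub>" for m
    by (cases "m = 1"; simp add: numeral_2_eq_2)+
  have "(LEAST m::nat. 0 < m \<and> add_pow ?F m \<one>\<^bsub>?F\<^esub> = \<zero>\<^bsub>?F\<^esub>) = 2"
    using * ** by (intro Least_equality) auto
  moreover have "\<exists>m::nat. 0 < m \<and> add_pow ?F m \<one>\<^bsub>?F\<^esub> = \<zero>\<^bsub>?F\<^esub>"
    using ** by (intro exI[of _ 2]) auto
  ultimately have "characteristic ?F = 2"
    by (simp add: characteristic_def)
  with assms show False by simp
qed

text \<open>The reduced form has too many variables to be anisotropic. Arbitrary representatives of
  a residual zero make the form small, and a nonzero residual coordinate lifts to absolute value
  1.\<close>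

lemma unit_diagonal_residue_isotropic:
  assumes "\<not> enat m \<le> u_invariant (residue_field k v)"
    and d: "\<And>i. i < m \<Longrightarrow> d i \<in> carrier k" "\<And>i. i < m \<Longrightarrow> v (d i) = 1"
  obtains x j where "x \<in> {..<m} \<rightarrow> carrier k" "\<And>i. i < m \<Longrightarrow> v (x i) \<le> 1" "j < m" "v (x j) = 1"
    "v (\<Oplus>i\<in>{..<m}. d i \<otimes> (x i \<otimes> x i)) < 1"
proof -
  let ?F = "residue_field k v" and ?V = "valuation_ring k v"
  interpret h: ring_hom_cring ?V ?F residue
    by (rule residue_hom)
  have V: "y \<in> carrier ?V \<longleftrightarrow> y \<in> carrier k \<and> v y \<le> 1" for y
    by (simp add: valuation_ring_def)
  have V_mult: "y \<otimes>\<^bsub>?V\<^esub> z = y \<otimes> z" for y z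
    by (simp add: valuation_ring_def)
  have dV: "d i \<in> carrier ?V" if "i < m" for i
    using d that by (simp add: V)
  define e where "e i = residue (d i)" for i
  define c where "c i j = (if i = j then e i else \<zero>\<^bsub>?F\<^esub>)" for i j :: nat
  have e: "e \<in> {..<m} \<rightarrow> carrier ?F"
    using dV by (auto simp: e_def)
  then have "quadratic_form ?F m c"
    by (auto simp: quadratic_form_def c_def)
  then have "\<not> anisotropic ?F m c"
    using assms(1) unfolding u_invariant_def by (auto intro: Sup_upper)
  then obtain X j where X: "X \<in> {..<m} \<rightarrow> carrier ?F" and zero: "qf_eval ?F m c X = \<zero>\<^bsub>?F\<^esub>"
    and j: "j < m" "X j \<noteq> \<zero>\<^bsub>?F\<^esub>"
    unfolding anisotropic_def by blast
  have "\<exists>y. y \<in> carrier ?V \<and> residue y = X i" if i: "i < m" for i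
  proof -
    from X i have "X i \<in> carrier ?F" by auto
    then show ?thesis by (rule residue_surj) (auto simp: V)
  qed
  then obtain x where x: "\<And>i. i < m \<Longrightarrow> x i \<in> carrier ?V" "\<And>i. i < m \<Longrightarrow> residue (x i) = X i"
    by metis
  let ?s = "\<Oplus>i\<in>{..<m}. d i \<otimes> (x i \<otimes> x i)"
  have summand: "d i \<otimes> (x i \<otimes> x i) \<in> carrier ?V" if "i < m" for i
    using dV[OF that] x(1)[OF that] h.R.m_closed by (simp flip: V_mult)
  have "\<zero>\<^bsub>?F\<^esub> = (\<Oplus>\<^bsub>?F\<^esub>i\<in>{..<m}. e i \<otimes>\<^bsub>?F\<^esub> (X i \<otimes>\<^bsub>?F\<^esub> X i))"
    using h.S.qf_eval_diagonal[OF e X] zero by (simp add: c_def[abs_def])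
  also have "\<dots> = (\<Oplus>\<^bsub>?F\<^esub>i\<in>{..<m}. residue (d i \<otimes> (x i \<otimes> x i)))"
    using summand x dV by (intro h.S.finsum_cong') (auto simp: e_def simp flip: V_mult)
  also have "\<dots> = residue (finsum ?V (\<lambda>i. d i \<otimes> (x i \<otimes> x i)) {..<m})"
    using summand by (subst h.hom_finsum) (auto simp: comp_def)
  also have "finsum ?V (\<lambda>i. d i \<otimes> (x i \<otimes> x i)) {..<m} = ?s"
    using summand by (intro finsum_valuation_ring) auto
  finally have "residue ?s = \<zero>\<^bsub>?F\<^esub>" by simp
  moreover have "?s \<in> carrier k" "v ?s \<le> 1"
    using summand by (auto intro!: finsum_closed val_finsum_le simp: V)
  ultimately have "v ?s < 1"
    by (simp add: residue_eq_zero_iff)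
  moreover have "v (x j) = 1"
    using residue_eq_zero_iff[of "x j"] j x[of j] by (force simp: V)
  ultimately show ?thesis
    using that[of x j] x j by (auto simp: V)
qed

end

text \<open>An approximate zero becomes exact by rescaling the one coordinate \<open>x j\<close> of
  absolute value 1, whose term \<open>p\<close> then has absolute value 1.\<close>

lemma (in complete_ultrametric_field) unit_diagonal_isotropic:
  assumes "\<not> enat m \<le> u_invariant (residue_field k v)" and two: "v (\<one> \<oplus> \<one>) = 1"
    and d: "\<And>i. i < m \<Longrightarrow> d i \<in> carrier k" "\<And>i. i < m \<Longrightarrow> v (d i) = 1"
  shows "\<not> diagonal_anisotropic {..<m} d"
proof
  assume aniso: "diagonal_anisotropic {..<m} d"
  obtain x j where x: "x \<in> {..<m} \<rightarrow> carrier k" "\<And>i. i < m \<Longrightarrow> v (x i) \<le> 1"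
    and j: "j < m" "v (x j) = 1" and small: "v (\<Oplus>i\<in>{..<m}. d i \<otimes> (x i \<otimes> x i)) < 1"
    by (rule unit_diagonal_residue_isotropic[of m d, OF assms(1) d]) (assumption | rule that)+
  define p where "p = d j \<otimes> (x j \<otimes> x j)"
  define s where "s = (\<Oplus>i\<in>{..<m} - {j}. d i \<otimes> (x i \<otimes> x i))"
  have xj: "x j \<in> carrier k" "d j \<in> carrier k"
    using x d j by auto
  have summand: "d i \<otimes> (x i \<otimes> x i) \<in> carrier k" if "i < m" for i
    using x d that by auto
  have p: "p \<in> carrier k" "v p = 1"
    using xj j d by (auto simp: p_def val_mult)
  have s: "s \<in> carrier k"
    unfolding s_def using summand by (intro finsum_closed) auto
  have split: "(\<Oplus>i\<in>{..<m}. f i) = f j \<oplus> (\<Oplus>i\<in>{..<m} - {j}. f i)" if "f \<in> {..<m} \<rightarrow> carrier k" for f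
  proof -
    have "{..<m} = insert j ({..<m} - {j})" using j by auto
    then show ?thesis
      using that j by (metis DiffE Pi_split_insert_domain finite_Diff finite_lessThan finsum_insert singletonI)
  qed
  have "v (p \<oplus> s) < 1"
    using small split[of "\<lambda>i. d i \<otimes> (x i \<otimes> x i)"] summand by (auto simp: p_def s_def)
  have "p \<noteq> \<zero>"
    using p by auto
  then have ip: "inv p \<in> carrier k" "p \<otimes> inv p = \<one>" "v (inv p) = 1"
    using p by (auto simp: field_Units val_inv)
  \<comment> \<open>The condition \<open>p z^2 = - s\<close> reads \<open>z^2 = - s / p\<close>,
    which is 1 minus the small quotient \<open>(p + s) / p\<close>.\<close>
  define a where "a = \<ominus> ((p \<oplus> s) \<otimes> inv p)"
  have a: "a \<in> carrier k" "v a < 1"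
    using p s ip \<open>v (p \<oplus> s) < 1\<close> by (auto simp: a_def val_mult)
  obtain z where z: "z \<in> carrier k" "z \<otimes> z = \<one> \<oplus> a"
    using one_plus_small_is_square[OF a two] by blast
  have "p \<otimes> (\<one> \<oplus> a) = p \<ominus> (p \<oplus> s) \<otimes> (p \<otimes> inv p)"
    unfolding a_def using p(1) s ip(1) by algebra
  also have "\<dots> = \<ominus> s"
    unfolding ip(2) using p(1) s by algebra
  finally have pz: "p \<otimes> (z \<otimes> z) = \<ominus> s"
    by (simp add: z)
  define y where "y = x(j := x j \<otimes> z)"
  have y: "y \<in> {..<m} \<rightarrow> carrier k"
    using x xj z by (auto simp: y_def)
  have "(\<Oplus>i\<in>{..<m}. d i \<otimes> (y i \<otimes> y i)) =
      d j \<otimes> (y j \<otimes> y j) \<oplus> (\<Oplus>i\<in>{..<m} - {j}. d i \<otimes> (y i \<otimes> y i))"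
    using y d by (intro split) auto
  also have "(\<Oplus>i\<in>{..<m} - {j}. d i \<otimes> (y i \<otimes> y i)) = s"
    unfolding s_def using summand by (intro finsum_cong') (auto simp: y_def)
  also have "d j \<otimes> (y j \<otimes> y j) = p \<otimes> (z \<otimes> z)"
    using xj z(1) by (simp add: y_def p_def m_ac)
  finally have "(\<Oplus>i\<in>{..<m}. d i \<otimes> (y i \<otimes> y i)) = \<zero>"
    using s by (simp add: pz l_neg)
  with aniso y j have "y j = \<zero>"
    unfolding diagonal_anisotropic_def by blast
  moreover have "x j \<noteq> \<zero>"
    using j by auto
  ultimately have "z = \<zero>"
    using xj z by (auto simp: y_def integral_iff)
  then have "s = \<zero>"
    using pz p s by (metis a_inv_closed minus_minus minus_zero r_null zero_closed)
  with \<open>v (p \<oplus> s) < 1\<close> p show False by simp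
qed


section \<open>The bound for u\<close>

lemma (in ultrametric_field) positive_real_group_value_group: "positive_real_group (value_group k v)"
proof
  show "0 < a" if "a \<in> value_group k v" for a
    using that val_pos by (auto simp: value_group_def)
  show "1 \<in> value_group k v"
    by (auto simp: value_group_def intro!: rev_image_eqI[of \<one>])
  show "a * b \<in> value_group k v" if "a \<in> value_group k v" "b \<in> value_group k v" for a b
  proof -
    from that obtain x y where "x \<in> carrier k" "x \<noteq> \<zero>" "a = v x" "y \<in> carrier k" "y \<noteq> \<zero>" "b = v y"
      by (auto simp: value_group_def)
    then show ?thesis
      unfolding value_group_def by (intro image_eqI[of _ _ "x \<otimes> y"]) (auto simp: val_mult integral_iff)
  qed
  show "inverse a \<in> value_group k v" if "a \<in> value_group k v" for a
  proof -
    from that obtain x where x: "x \<in> carrier k" "x \<noteq> \<zero>" "a = v x"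
      by (auto simp: value_group_def)
    then have "inv x \<in> carrier k" "v (inv x) = inverse a"
      by (auto simp: val_inv field_Units)
    moreover from this x have "inv x \<noteq> \<zero>"
      using val_pos[of x] by (metis inverse_zero_imp_zero less_irrefl val_zero)
    ultimately show ?thesis
      unfolding value_group_def by (intro image_eqI[of _ _ "inv x"]) auto
  qed
qed

text \<open>The number \<open>g\<close> is a common factor moving the whole class into the squares
  of the value group. Scaling by an element of value \<open>g\<close> and by suitable squares turns
  every entry into a unit.\<close>

lemma (in complete_ultrametric_field) square_class_diagonal_bound:
  assumes two: "v (\<one> \<oplus> \<one>) = 1" and "finite I"
    and d: "d \<in> I \<rightarrow> carrier k" "diagonal_anisotropic I d"
    and g: "g \<in> value_group k v" "\<And>i. i \<in> I \<Longrightarrow> \<exists>h\<in>value_group k v. v (d i) * g = h\<^sup>2"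
  shows "enat (card I) \<le> u_invariant (residue_field k v)"
proof (rule ccontr)
  assume large: "\<not> enat (card I) \<le> u_invariant (residue_field k v)"
  interpret G: positive_real_group "value_group k v"
    by (rule positive_real_group_value_group)
  obtain a where a: "a \<in> carrier k" "a \<noteq> \<zero>" "v a = g"
    using g(1) by (auto simp: value_group_def)
  \<comment> \<open>Take \<open>b\<close> with absolute value \<open>1 / h\<close>.\<close>
  have "\<exists>b. b \<in> carrier k \<and> b \<noteq> \<zero> \<and> v a * (v (d i) * (v b * v b)) = 1" if i: "i \<in> I" for i
  proof -
    obtain h where h: "h \<in> value_group k v" "v (d i) * g = h\<^sup>2"
      using g(2)[OF i] by blast
    obtain b where b: "b \<in> carrier k" "b \<noteq> \<zero>" "inverse h = v b"
      using G.inverse_mem[OF h(1)] unfolding value_group_def by blast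
    have "v a * (v (d i) * (v b * v b)) = (v (d i) * g) * (inverse h)\<^sup>2"
      by (simp add: a b(3) power2_eq_square)
    also have "\<dots> = 1"
      unfolding h(2) using G.pos[OF h(1)] by (simp add: field_simps)
    finally show ?thesis
      using b by blast
  qed
  then obtain b where b: "\<And>i. i \<in> I \<Longrightarrow> b i \<in> carrier k" "\<And>i. i \<in> I \<Longrightarrow> b i \<noteq> \<zero>"
      "\<And>i. i \<in> I \<Longrightarrow> v a * (v (d i) * (v (b i) * v (b i))) = 1"
    by metis
  define d' where "d' i = a \<otimes> (d i \<otimes> (b i \<otimes> b i))" for i
  have d': "d' i \<in> carrier k" "v (d' i) = 1" if "i \<in> I" for i
  proof -
    have "d i \<in> carrier k" using d(1) that by auto
    then show "d' i \<in> carrier k" "v (d' i) = 1"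
      using b[OF that] a(1) by (simp_all add: d'_def val_mult)
  qed
  have aniso: "diagonal_anisotropic I d'"
    unfolding d'_def using d a b by (intro diagonal_anisotropic_scale) auto
  obtain e where e: "bij_betw e {..<card I} I"
    using ex_bij_betw_nat_finite[OF \<open>finite I\<close>] by (auto simp: atLeast0LessThan)
  have "diagonal_anisotropic {..<card I} (d' \<circ> e)"
    using aniso e d' by (intro diagonal_anisotropic_reindex) (auto simp: bij_betw_def)
  moreover have "e i \<in> I" if "i < card I" for i
    using e that by (auto simp: bij_betw_def)
  ultimately show False
    using unit_diagonal_isotropic[OF large two, of "d' \<circ> e"] d' by auto
qed

lemma enat_two_power: "(2 :: enat) ^ n = enat (2 ^ n)"
  by (induction n) (simp_all add: one_enat_def numeral_eq_enat)

theorem theorem1p1: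
  fixes k :: "('a, 'b) ring_scheme" and v :: "'a \<Rightarrow> real" and n :: nat
  assumes "complete_ultrametric_field k v"
    and "characteristic (residue_field k v) \<noteq> 2"
    and "vectorspace.fin_dim (class_ring :: rat ring)
           (divisible_closure_space (value_group k v))"
    and "vectorspace.dim (class_ring :: rat ring)
           (divisible_closure_space (value_group k v)) = n"
  shows "u_invariant k \<le> 2 ^ n * u_invariant (residue_field k v)"
proof (cases "u_invariant (residue_field k v)")
  case infinity
  \<comment> \<open>The factor \<open>2 ^ n\<close> is nonzero, so the right-hand side is
    infinite.\<close>
  then show ?thesis by (simp add: enat_two_power)
next
  case (enat N)
  interpret complete_ultrametric_field k v
    by (rule assms(1))
  interpret G: positive_real_group "value_group k v"
    by (rule positive_real_group_value_group)
  have two: "v (\<one>\<^bsub>k\<^esub> \<oplus>\<^bsub>k\<^esub> \<one>\<^bsub>k\<^esub>) = 1"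
    by (rule val_two_eq_one[OF assms(2)])
  obtain S where S: "finite S" "card S \<le> n" "S \<subseteq> value_group k v"
    and rep: "\<And>g. g \<in> value_group k v \<Longrightarrow> \<exists>T\<subseteq>S. \<exists>h\<in>value_group k v. g * \<Prod>T = h\<^sup>2"
    using G.square_class_representatives[OF assms(3,4)] by blast
  have "m \<le> 2 ^ n * N" if qf: "quadratic_form k m c" "anisotropic k m c" for m c
  proof -
    have "\<one>\<^bsub>k\<^esub> \<oplus>\<^bsub>k\<^esub> \<one>\<^bsub>k\<^esub> \<noteq> \<zero>\<^bsub>k\<^esub>"
      using two by auto
    then obtain d where d: "d \<in> {..<m} \<rightarrow> carrier k" "diagonal_anisotropic {..<m} d"
      using anisotropic_imp_diagonal_anisotropic[OF qf] by blast
    have "v (d i) \<in> value_group k v" if "i < m" for i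
      using d that diagonal_anisotropic_nonzero[OF d(2) _ _ d(1), of i] by (auto simp: value_group_def)
    then have "\<forall>i\<in>{..<m}. \<exists>U. U \<subseteq> S \<and> (\<exists>h\<in>value_group k v. v (d i) * \<Prod>U = h\<^sup>2)"
      using rep by blast
    from bchoice[OF this] obtain T where T: "\<And>i. i < m \<Longrightarrow> T i \<subseteq> S"
      "\<And>i. i < m \<Longrightarrow> \<exists>h\<in>value_group k v. v (d i) * \<Prod>(T i) = h\<^sup>2"
      by blast
    \<comment> \<open>Pigeonhole: \<open>T\<close> maps the \<open>m\<close> indices into the
      subsets of \<open>S\<close>, of which there are at most \<open>2 ^ n\<close>.\<close>
    have "\<exists>U\<in>Pow S. card (T -` {U} \<inter> {..<m}) * card (Pow S) \<ge> card {..<m}"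
      using T(1) S(1) by (intro pigeonhole_card) auto
    then obtain U where U: "U \<subseteq> S" "m \<le> card (T -` {U} \<inter> {..<m}) * 2 ^ card S"
      using S(1) by (auto simp: card_Pow)
    let ?I = "T -` {U} \<inter> {..<m}"
    have "enat (card ?I) \<le> enat N"
      unfolding enat[symmetric]
    proof (rule square_class_diagonal_bound[OF two])
      show "d \<in> ?I \<rightarrow> carrier k"
        using d by auto
      show "diagonal_anisotropic ?I d"
        using d by (intro diagonal_anisotropic_subset[OF d(2)]) auto
      show "\<Prod>U \<in> value_group k v"
        using U S by (intro G.prod_mem) auto
      show "\<exists>h\<in>value_group k v. v (d i) * \<Prod>U = h\<^sup>2" if "i \<in> ?I" for i
        using T(2)[of i] that by auto
    qed simp
    then have "m \<le> N * 2 ^ card S"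
      using U(2) by (meson enat_ord_simps(1) le_trans mult_le_mono1)
    also have "\<dots> \<le> N * 2 ^ n"
      using S(2) by (intro mult_left_mono power_increasing) auto
    finally show ?thesis by (simp add: mult.commute)
  qed
  then have "u_invariant k \<le> enat (2 ^ n * N)"
    unfolding u_invariant_def by (auto intro!: Sup_least)
  also have "\<dots> = 2 ^ n * u_invariant (residue_field k v)"
    by (simp add: enat enat_two_power)
  finally show ?thesis .
qed

end
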